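(* Assume the ABC conjecture. Let $k\geq 3$ and $n\neq 0$ be integers, and let $(A,B)$ be a bipartite Diophantine tuple with property $BD_k(n)$. (1) If $|A|=2$ and $k\geq 6$, then for each $\varepsilon>0$, $$|B|\ll_{k,\varepsilon}|n|^{\frac{(k-1)\phi(k)}{k(k^2-6k+3)}+\varepsilon}.$$ (2) If $|A|=3$, then for each $\varepsilon>0$, we have $|B|\ll_{\varepsilon}|n|^{\frac{3}{8}+\varepsilon}$ if $k=4$, and $|B|\ll_{\varepsilon}|n|^{\frac{64}{625}+\varepsilon}$ if $k=5$. (3) If $|A|=5$ and $k=3$, then for each $\varepsilon>0$, we have $|B|\ll_{\varepsilon}|n|^{\frac{32}{81}+\varepsilon}$.
   Context: For integers $k\geq 2$ and $n\neq 0$, a pair $(A,B)$ is a bipartite Diophantine tuple with property $BD_k(n)$ if $A,B$ are two sets of positive integers, each of size at least $2$, such that $ab+n$ is a perfect $k$-th power (the $k$-th power of an integer) for each $a\in A$ and $b\in B$. $\phi$ is Euler's totient function. The notation $X\ll_{S}Y$ means $|X|\leq CY$ for a constant $C>0$ depending only on the parameters listed in $S$ (in particular, not on $n$, $A$, $B$); the bounds include the assertion that $B$ is finite. ABC conjecture: for a nonzero integer $N$ let $\operatorname{rad}(N)=\prod_{p\mid N}p$ (product over primes). For each $\varepsilon>0$ there is a constant $K_\varepsilon$ such that whenever $a,b,c$ are nonzero integers with $\gcd(a,b,c)=1$ and $a+b=c$, we have $\max\{|a|,|b|,|c|\}\leq K_\varepsilon\operatorname{rad}(abc)^{1+\varepsilon}$.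 *)

theory Defs
  imports
    Complex_Main
    "HOL-Computational_Algebra.Computational_Algebra"
    "HOL-Number_Theory.Totient"
begin

definition rad :: "int \<Rightarrow> int" where
  "rad N = (\<Prod>p | prime p \<and> p dvd N. p)"

definition ABC_conjecture :: bool where
  "ABC_conjecture \<longleftrightarrow>
     (\<forall>\<epsilon>::real. \<epsilon> > 0 \<longrightarrow>
       (\<exists>K::real. \<forall>a b c :: int.
          a \<noteq> 0 \<longrightarrow> b \<noteq> 0 \<longrightarrow> c \<noteq> 0 \<longrightarrow> gcd a (gcd b c) = 1 \<longrightarrow> a + b = c \<longrightarrow>
          real_of_int (Max {\<bar>a\<bar>, \<bar>b\<bar>, \<bar>c\<bar>})
            \<le> K * real_of_int (rad (a * b * c)) powr (1 + \<epsilon>)))"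

text \<open>
  The sets may a priori be infinite, so ``size at least 2'' cannot be stated by
  \<^const>\<open>card\<close> alone. \<^term>\<open>is_nth_power k (a * b + n)\<close> is taken over the
  integers: the root may be zero or negative.
\<close>

definition bipartite_diophantine :: "nat \<Rightarrow> int \<Rightarrow> int set \<Rightarrow> int set \<Rightarrow> bool" where
  "bipartite_diophantine k n A B \<longleftrightarrow>
     (\<forall>a\<in>A. a > 0) \<and> (\<forall>b\<in>B. b > 0) \<and>
     (infinite A \<or> card A \<ge> 2) \<and> (infinite B \<or> card B \<ge> 2) \<and>
     (\<forall>a\<in>A. \<forall>b\<in>B. is_nth_power k (a * b + n))"

end

theory Submission
  imports Defs "HOL-Number_Theory.Residues"
begin

text \<open>
  The bound obtained is \<open>card B \<le> C |n|\<^sup>\<epsilon>\<close> for every \<open>\<epsilon> > 0\<close>, under the conditions that \<open>A\<close> has at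
  least two elements and \<open>k \<ge> 5\<close>, or three elements and \<open>k = 4\<close>, or four elements and
  \<open>k = 3\<close>. The exponents of the theorem are nonnegative, so this implies all of its parts.

  If \<open>a b + n = x\<^sup>k\<close> and \<open>a' b + n = y\<^sup>k\<close>, then \<open>a' x\<^sup>k - a y\<^sup>k = n (a' - a)\<close>: every element of
  \<open>B\<close> gives a solution of a binomial Thue equation that depends only on \<open>n\<close> and two elements
  \<open>a < a'\<close> of \<open>A\<close>. Write \<open>a < a'\<close> for the two least elements of \<open>A\<close>. The argument
  splits according to whether \<open>a'\<close> is at most a fixed power of \<open>|n|\<close>.

  If it is, ABC applied to the Thue equation bounds \<open>B\<close> by a power of \<open>|n|\<close> as well, and the solutions
  can be counted directly (\<open>card_thue\<close>). For an equation \<open>p x\<^sup>k - q y\<^sup>k = h\<close> the solutions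
  are sorted into classes: by the common divisors of \<open>x\<close>, \<open>y\<close> and the two terms with \<open>h\<close>, and by the
  residue of \<open>x / y\<close> modulo each prime factor of the part \<open>N\<close> of \<open>h\<close> that remains after those divisors
  are removed, together with some bounded data modulo \<open>k\<^sup>2\<close>. The residue of \<open>x / y\<close> is a root of a
  congruence of degree \<open>k\<close>, so the divisor bound leaves \<open>|h|\<^sup>\<epsilon>\<close> classes up to a constant. Two solutions in one class satisfy \<open>N dvd k (x y' - x' y)\<close>. Such a
  determinant is either zero or at least \<open>N / k\<close> in absolute value, while the shape of the equation
  bounds it from above; together this forces \<open>y' > y\<^sup>2\<close> or, depending on the sign of \<open>h\<close>, \<open>x' > x\<^sup>2\<close> for
  consecutive solutions (\<open>thue_gap\<close>), so that a class has only logarithmically many members. Negative values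
  of \<open>a b + n\<close> lead to sums of two powers, where a class has boundedly many members
  (\<open>card_thue_class_definite\<close>).

  If \<open>a'\<close> is larger than that power of \<open>|n|\<close>, then \<open>card B\<close> is bounded by a constant
  (\<open>card_le_of_large_second_element\<close>). ABC and its mirror image, in which \<open>A\<close> and \<open>B\<close> exchange
  roles, place the logarithms of all but the least element of \<open>B\<close> between two constant multiples of \<open>ln a'\<close>.
  If there were many of them, two would have almost the same logarithm \<open>\<beta>\<close>. For
  such a pair the gap principle (\<open>gap_log_bound\<close>) says, up to negligible terms, that consecutive elements of \<open>A\<close>
  have logarithms with \<open>l' \<ge> (k - 1) l + (k - 2) \<beta>\<close>, so the logarithms of \<open>A\<close> grow geometrically,
  whereas ABC says that every one of them is at most \<open>(k + 2) \<beta> / (k - 2)\<close>. With the number of elements of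
  \<open>A\<close> listed above these two are incompatible (\<open>log_chain_bound\<close>).
\<close>

section \<open>Gaps between solutions in one residue class\<close>

lemma power_add_second_order:
  fixes b w :: int
  shows "\<exists>s. (b + w) ^ k = b ^ k + int k * b ^ (k - 1) * w + w\<^sup>2 * s"
proof (induction k)
  case 0
  show ?case by (rule exI[of _ 0]) simp
next
  case (Suc k)
  then obtain s where s: "(b + w) ^ k = b ^ k + int k * b ^ (k - 1) * w + w\<^sup>2 * s" by blast
  have b: "int k * b ^ (k - 1) * b = int k * b ^ k" by (cases k) simp_all
  have "(b + w) ^ Suc k = (b + w) * (b ^ k + int k * b ^ (k - 1) * w + w\<^sup>2 * s)"
    by (simp add: s)
  also have "\<dots> = b ^ Suc k + (b ^ k + int k * b ^ (k - 1) * b) * w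
                + w\<^sup>2 * (int k * b ^ (k - 1) + (b + w) * s)"
    by (simp add: algebra_simps power2_eq_square)
  also have "\<dots> = b ^ Suc k + int (Suc k) * b ^ (Suc k - 1) * w
                + w\<^sup>2 * (int k * b ^ (k - 1) + (b + w) * s)"
    unfolding b by (simp add: algebra_simps)
  finally show ?case by blast
qed

text \<open>
  Writing \<open>a = b + w\<close>, the difference of powers is \<open>k w\<close> times a cofactor that is congruent to
  \<open>b ^ (k - 1)\<close> modulo \<open>w / k\<close>. The last two hypotheses make \<open>w / k\<close> divisible by every prime factor of
  \<open>N\<close>, those dividing \<open>k\<close> included; hence the cofactor is coprime to \<open>N\<close> and can be cancelled.
\<close>

lemma dvd_power_diff_imp_dvd_diff:
  fixes a b N :: int
  assumes k: "k > 0" and N0: "N \<noteq> 0" and N: "N dvd a ^ k - b ^ k" and cop: "coprime b N"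
    and pr: "\<And>p. prime p \<Longrightarrow> p dvd N \<Longrightarrow> p dvd a - b" and k2: "(int k)\<^sup>2 dvd a - b"
  shows "N dvd int k * (a - b)"
proof -
  define w where "w = a - b"
  obtain s where s: "(b + w) ^ k = b ^ k + int k * b ^ (k - 1) * w + w\<^sup>2 * s"
    using power_add_second_order by blast
  obtain v where v: "w = int k * v"
    using k2 unfolding w_def by (metis dvdE power2_eq_square mult.assoc)
  have kv: "int k dvd v"
    using k2 k unfolding w_def[symmetric] v power2_eq_square by simp
  \<comment> \<open>the cofactor of \<open>k w\<close> in \<open>a ^ k - b ^ k\<close>\<close>
  define c where "c = b ^ (k - 1) + v * s"
  have eq: "a ^ k - b ^ k = (int k * w) * c"
  proof -
    have "a = b + w" by (simp add: w_def)
    then have "a ^ k - b ^ k = int k * b ^ (k - 1) * w + w * (int k * v) * s"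
      using s v by (simp add: power2_eq_square)
    then show ?thesis by (simp add: c_def algebra_simps)
  qed
  have "coprime c N"
  proof (rule ccontr)
    assume "\<not> coprime c N"
    then obtain p where p: "prime p" "p dvd c" "p dvd N"
    proof -
      have "\<not> is_unit (gcd c N)" "gcd c N \<noteq> 0"
        using \<open>\<not> coprime c N\<close> N0 by (simp_all add: coprime_iff_gcd_eq_1)
      then obtain p where "prime p" "p dvd gcd c N" by (meson prime_divisorE)
      then show ?thesis using that by simp
    qed
    have "p dvd v"
    proof (cases "p dvd int k")
      case True
      then show ?thesis using kv by (rule dvd_trans)
    next
      case False
      moreover have "p dvd int k * v" using pr[OF p(1,3)] v w_def by simp
      ultimately show ?thesis using p(1) by (simp add: prime_dvd_mult_iff)
    qed
    then have "p dvd b ^ (k - 1)"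
      using p(2) unfolding c_def by (metis dvd_add_left_iff dvd_mult2)
    then have "p dvd b" using p(1) prime_dvd_power by blast
    then show False using cop p by (meson coprime_common_divisor not_prime_unit)
  qed
  then show ?thesis
    using N unfolding eq w_def by (simp add: coprime_commute coprime_dvd_mult_left_iff)
qed

lemma power_diff_ge:
  fixes u v :: int
  assumes "0 \<le> v" "v \<le> u" "k > 0"
  shows "int k * v ^ (k - 1) * (u - v) \<le> u ^ k - v ^ k"
proof -
  have "int k * v ^ (k - 1) = (\<Sum>i<k. v ^ (k - Suc i) * v ^ i)"
  proof -
    have "(\<Sum>i<k. v ^ (k - Suc i) * v ^ i) = (\<Sum>i<k. v ^ (k - 1))"
      by (intro sum.cong) (auto simp flip: power_add)
    then show ?thesis by simp
  qed
  also have "\<dots> \<le> (\<Sum>i<k. v ^ (k - Suc i) * u ^ i)"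
    using assms by (intro sum_mono mult_left_mono power_mono) auto
  finally have "int k * v ^ (k - 1) * (u - v) \<le> (\<Sum>i<k. v ^ (k - Suc i) * u ^ i) * (u - v)"
    using assms by (intro mult_right_mono) auto
  also have "\<dots> = u ^ k - v ^ k"
    using power_diff_sumr2[of u k v] by (simp add: mult.commute)
  finally show ?thesis .
qed

text \<open>
  Eliminating one of the two coefficients from a pair of solutions relates the
  determinant \<open>x y' - x' y\<close> to the growth of either coordinate.
\<close>

lemma thue_cross_identity:
  fixes \<rho> \<sigma> N :: int
  assumes "\<rho> * x ^ k - \<sigma> * y ^ k = N" "\<rho> * x' ^ k - \<sigma> * y' ^ k = N"
  shows "\<rho> * ((x * y') ^ k - (x' * y) ^ k) = N * (y' ^ k - y ^ k)"
    and "\<sigma> * ((x * y') ^ k - (x' * y) ^ k) = N * (x' ^ k - x ^ k)"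
proof -
  have "\<rho> * ((x * y') ^ k - (x' * y) ^ k) = (\<rho> * x ^ k) * y' ^ k - (\<rho> * x' ^ k) * y ^ k"
    by (simp add: algebra_simps power_mult_distrib)
  also have "\<dots> = (N + \<sigma> * y ^ k) * y' ^ k - (N + \<sigma> * y' ^ k) * y ^ k"
    using assms by (simp add: algebra_simps)
  finally show "\<rho> * ((x * y') ^ k - (x' * y) ^ k) = N * (y' ^ k - y ^ k)"
    by (simp add: algebra_simps)
  have "\<sigma> * ((x * y') ^ k - (x' * y) ^ k) = x ^ k * (\<sigma> * y' ^ k) - x' ^ k * (\<sigma> * y ^ k)"
    by (simp add: algebra_simps power_mult_distrib)
  also have "\<dots> = x ^ k * (\<rho> * x' ^ k - N) - x' ^ k * (\<rho> * x ^ k - N)"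
    using assms by (simp add: algebra_simps)
  finally show "\<sigma> * ((x * y') ^ k - (x' * y) ^ k) = N * (x' ^ k - x ^ k)"
    by (simp add: algebra_simps)
qed

text \<open>
  By the divisibility, \<open>k (x y' - x' y) \<ge> N\<close>, so the difference \<open>(x y')\<^sup>k - (x' y)\<^sup>k\<close> is at least
  \<open>N (x' y) ^ (k - 1)\<close>. The two cross identities bound it from above by \<open>N y'\<^sup>k\<close> and
  \<open>N x'\<^sup>k\<close>. The factor \<open>N\<close> cancels, which gives \<open>x' > y ^ (k - 1)\<close> first and then
  \<open>y' > y ^ (k - 1)\<close>.
\<close>

lemma thue_gap:
  fixes \<rho> \<sigma> N :: int
  assumes pos: "\<rho> > 0" "\<sigma> > 0" "N > 0" "x > 0" "y > 0" "x' > 0" "y' > 0" and k: "k \<ge> 3"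
    and eq: "\<rho> * x ^ k - \<sigma> * y ^ k = N" "\<rho> * x' ^ k - \<sigma> * y' ^ k = N"
    and dvd: "N dvd int k * (x * y' - x' * y)" and less: "y < y'"
  shows "y\<^sup>2 < y'"
proof -
  note id = thue_cross_identity[OF eq]
  define D where "D = (x * y') ^ k - (x' * y) ^ k"
  have "y ^ k < y' ^ k" using less pos k by (intro power_strict_mono) auto
  then have "\<rho> * D > 0" using id(1) pos D_def by simp
  then have "D > 0" using pos by (simp add: zero_less_mult_iff)
  then have gt: "x * y' > x' * y"
    unfolding D_def using pos power_less_imp_less_base[of "x' * y" k "x * y'"] by simp
  have N_le: "N \<le> int k * (x * y' - x' * y)"
    using dvd gt k by (intro zdvd_imp_le) auto
  have "N * (x' * y) ^ (k - 1) \<le> int k * (x * y' - x' * y) * (x' * y) ^ (k - 1)"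
    using N_le pos by (intro mult_right_mono) auto
  also have "\<dots> \<le> D"
    using power_diff_ge[of "x' * y" "x * y'" k] gt pos k by (simp add: D_def mult_ac)
  finally have D_ge: "N * (x' * y) ^ (k - 1) \<le> D" .
  \<comment> \<open>Both cross identities have this shape, with \<open>\<tau>\<close> one of the coefficients.\<close>
  have aux: "(x' * y) ^ (k - 1) < u' ^ k"
    if "\<tau> > 0" "\<tau> * D = N * (u' ^ k - u ^ k)" "u > 0" for \<tau> u u' :: int
  proof -
    have "N * (x' * y) ^ (k - 1) \<le> D" by (rule D_ge)
    also have "\<dots> \<le> \<tau> * D" using mult_right_mono[of 1 \<tau> D] that(1) \<open>D > 0\<close> by simp
    also have "\<dots> = N * (u' ^ k - u ^ k)" by (rule that)
    finally have "N * (x' * y) ^ (k - 1) \<le> N * (u' ^ k - u ^ k)" .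
    then have "(x' * y) ^ (k - 1) \<le> u' ^ k - u ^ k" using pos by simp
    also have "\<dots> < u' ^ k" using that by simp
    finally show ?thesis .
  qed
  have k': "k = Suc (k - 1)" using k by simp
  have "(x' * y) ^ (k - 1) < x' ^ k"
    using aux[OF pos(2) id(2)[folded D_def]] pos by simp
  then have "x' ^ (k - 1) * y ^ (k - 1) < x' ^ (k - 1) * x'"
    by (metis k' power_Suc2 power_mult_distrib)
  then have x': "y ^ (k - 1) < x'" using pos by simp
  have "(y ^ (k - 1)) ^ k = (y ^ (k - 1) * y) ^ (k - 1)"
    by (metis k' power_Suc2 power_mult mult.commute)
  also have "\<dots> \<le> (x' * y) ^ (k - 1)"
    using x' pos by (intro power_mono mult_right_mono) auto
  also have "\<dots> < y' ^ k"
    using aux[OF pos(1) id(1)[folded D_def]] pos by simp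
  finally have "y ^ (k - 1) < y'"
    using pos by (meson power_less_imp_less_base less_imp_le)
  moreover have "y\<^sup>2 \<le> y ^ (k - 1)"
    using pos k by (intro power_increasing) auto
  ultimately show ?thesis by simp
qed

text \<open>
  Squaring gaps make the binary logarithms of the elements have distinct integer parts.
\<close>

lemma card_le_log2:
  fixes V :: "int set"
  assumes fin: "finite V" and pos: "\<And>v. v \<in> V \<Longrightarrow> 0 < v \<and> real_of_int v \<le> H"
    and gap: "\<And>v v'. v \<in> V \<Longrightarrow> v' \<in> V \<Longrightarrow> v < v' \<Longrightarrow> v\<^sup>2 < v'" and H: "H \<ge> 1"
  shows "real (card V) \<le> log 2 H + 1"
proof -
  define f where "f = (\<lambda>v::int. nat \<lfloor>log 2 v\<rfloor>)"
  have f_less: "f v < f v'" if "v \<in> V" "v' \<in> V" "v < v'" for v v'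
  proof -
    have "2 * v \<le> v'"
    proof (cases "v = 1")
      case False
      then have "2 * v \<le> v\<^sup>2" using pos[OF that(1)] by (simp add: power2_eq_square)
      then show ?thesis using gap[OF that] by simp
    qed (use that in auto)
    then have "2 * real_of_int v \<le> real_of_int v'"
      by linarith
    then have "log 2 (2 * real_of_int v) \<le> log 2 v'"
      using pos[OF that(1)] pos[OF that(2)] by simp
    then have "log 2 v + 1 \<le> log 2 v'"
      using pos[OF that(1)] by (simp add: log_mult)
    then have "\<lfloor>log 2 v\<rfloor> + 1 \<le> \<lfloor>log 2 v'\<rfloor>"
      by linarith
    moreover have "0 \<le> \<lfloor>log 2 v\<rfloor>" using pos[OF that(1)] by simp
    ultimately show ?thesis unfolding f_def by linarith
  qed
  have "inj_on f V"
    by (rule inj_onI) (metis f_less less_irrefl linorder_neqE)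
  moreover have "f ` V \<subseteq> {..nat \<lfloor>log 2 H\<rfloor>}"
  proof safe
    fix v assume "v \<in> V"
    then have "log 2 v \<le> log 2 H" using pos H by simp
    then show "f v \<le> nat \<lfloor>log 2 H\<rfloor>"
      unfolding f_def by (intro nat_mono floor_mono)
  qed
  ultimately have "card V \<le> card {..nat \<lfloor>log 2 H\<rfloor>}"
    by (intro card_inj_on_le) auto
  then have "real (card V) \<le> real (nat \<lfloor>log 2 H\<rfloor>) + 1" by simp
  also have "\<dots> \<le> log 2 H + 1" using H by simp
  finally show ?thesis .
qed

text \<open>
  A set of positive solutions that is small because of a divisibility of its determinants;
  it carries exactly the hypotheses that the gap argument needs, and is preserved when the coordinates and the
  coefficients are exchanged and \<open>N\<close> changes sign. The coefficient \<open>\<sigma>\<close> may be negative, which covers equations with a sum of two powers.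
\<close>

definition thue_class :: "nat \<Rightarrow> int \<Rightarrow> int \<Rightarrow> int \<Rightarrow> (int \<times> int) set \<Rightarrow> bool" where
  "thue_class k \<rho> \<sigma> N S \<longleftrightarrow>
     (\<forall>(x, y)\<in>S. x > 0 \<and> y > 0 \<and> \<rho> * x ^ k - \<sigma> * y ^ k = N) \<and>
     (\<forall>(x, y)\<in>S. \<forall>(x', y')\<in>S. N dvd int k * (x * y' - x' * y))"

lemma thue_classD:
  assumes "thue_class k \<rho> \<sigma> N S" "(x, y) \<in> S"
  shows "x > 0" "y > 0" "\<rho> * x ^ k - \<sigma> * y ^ k = N"
  using assms unfolding thue_class_def by auto

lemma thue_class_dvd:
  assumes "thue_class k \<rho> \<sigma> N S" "(x, y) \<in> S" "(x', y') \<in> S"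
  shows "N dvd int k * (x * y' - x' * y)"
  using assms unfolding thue_class_def by auto

lemma thue_class_swap:
  assumes "thue_class k \<rho> \<sigma> N S"
  shows "thue_class k \<sigma> \<rho> (- N) (prod.swap ` S)"
  unfolding thue_class_def
proof (intro conjI)
  show "\<forall>(x, y)\<in>prod.swap ` S. x > 0 \<and> y > 0 \<and> \<sigma> * x ^ k - \<rho> * y ^ k = - N"
    using assms by (auto simp: thue_class_def)
  show "\<forall>(x, y)\<in>prod.swap ` S. \<forall>(x', y')\<in>prod.swap ` S. - N dvd int k * (x * y' - x' * y)"
  proof -
    have "- N dvd int k * (x * y' - x' * y)" if "(y, x) \<in> S" "(y', x') \<in> S" for x y x' y'
    proof -
      have "N dvd int k * (y' * x - y * x')"
        using assms that unfolding thue_class_def by blast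
      then show ?thesis by (simp add: mult.commute)
    qed
    then show ?thesis by auto
  qed
qed

lemma thue_class_inj_snd:
  assumes S: "thue_class k \<rho> \<sigma> N S" and k: "k > 0" and "\<rho> \<noteq> 0"
  shows "inj_on snd S"
proof (rule inj_onI, clarify)
  fix x y x' y' assume xy: "(x, y) \<in> S" "(x', y') \<in> S" "snd (x, y) = snd (x', y')"
  then have y: "y = y'" by simp
  note * = thue_classD[OF S xy(1)] thue_classD[OF S xy(2)]
  have "\<rho> * x ^ k = \<rho> * x' ^ k" using *(3,6) unfolding y by linarith
  then have "x ^ k = x' ^ k" using assms by simp
  then show "x = x' \<and> y = y'" using * y k by (simp add: power_eq_iff_eq_base)
qed

lemma card_thue_class_pos:
  assumes S: "thue_class k \<rho> \<sigma> N S" and k: "k \<ge> 3" and pos: "\<rho> > 0" "\<sigma> > 0" "N > 0"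
    and fin: "finite S" and H: "\<And>x y. (x, y) \<in> S \<Longrightarrow> real_of_int y \<le> H" "H \<ge> 1"
  shows "real (card S) \<le> log 2 H + 1"
proof -
  have "real (card (snd ` S)) \<le> log 2 H + 1"
  proof (rule card_le_log2)
    fix v v' assume "v \<in> snd ` S" "v' \<in> snd ` S" "v < v'"
    then obtain x x' where xy: "(x, v) \<in> S" "(x', v') \<in> S" by auto
    note * = thue_classD[OF S xy(1)] thue_classD[OF S xy(2)]
    show "v\<^sup>2 < v'"
      by (rule thue_gap[OF pos *(1,2,4,5) k *(3,6) thue_class_dvd[OF S xy]]) fact
  next
    fix v assume "v \<in> snd ` S"
    then show "0 < v \<and> real_of_int v \<le> H" using thue_classD(2)[OF S] H by auto
  qed (use fin H in auto)
  moreover have "card (snd ` S) = card S"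
    using thue_class_inj_snd[OF S] k pos by (intro card_image) auto
  ultimately show ?thesis by simp
qed

text \<open>
  For negative \<open>\<sigma>\<close> both coordinates are at most the \<open>k\<close>-th root of \<open>N\<close>, so a determinant is
  at most \<open>N\<close> to the power \<open>2 / k \<le> 2 / 3\<close>. If it is a nonzero multiple of \<open>N / k\<close>, this gives
  \<open>N \<le> k ^ 3\<close>, and there is room for at most \<open>k ^ 3\<close> solutions.
\<close>

lemma card_thue_class_definite:
  assumes S: "thue_class k \<rho> \<sigma> N S" and k: "k \<ge> 3" and pos: "\<rho> > 0" "\<sigma> < 0"
    and fin: "finite S"
  shows "card S \<le> k ^ 3"
proof (cases "card S \<le> 1")
  case True
  also have "1 \<le> k ^ 3" using k by (intro one_le_power) auto
  finally show ?thesis .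
next
  case False
  have small: "x ^ k \<le> N \<and> y ^ k \<le> N \<and> x > 0 \<and> y > 0" if "(x, y) \<in> S" for x y
  proof -
    note xy = thue_classD[OF S that]
    have "x ^ k \<le> \<rho> * x ^ k" "y ^ k \<le> - \<sigma> * y ^ k" 
      using mult_right_mono[of 1 \<rho> "x ^ k"] mult_right_mono[of 1 "- \<sigma>" "y ^ k"] xy pos by simp_all
    moreover have "0 < x ^ k" "0 < y ^ k" using xy by simp_all
    ultimately show ?thesis using xy by linarith
  qed
  obtain P Q where PQ: "P \<in> S" "Q \<in> S" "P \<noteq> Q"
    using False fin by (metis card_le_Suc0_iff_eq One_nat_def)
  obtain x y x' y' where P: "P = (x, y)" and Q: "Q = (x', y')" by (metis surj_pair)
  have "inj_on snd S"
    using thue_class_inj_snd[OF S] k pos by simp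
  then have y_ne: "y \<noteq> y'"
    using PQ unfolding P Q by (metis inj_onD snd_conv)
  have sm: "x ^ k \<le> N" "y ^ k \<le> N" "x > 0" "y > 0" "x' ^ k \<le> N" "y' ^ k \<le> N" "x' > 0" "y' > 0"
    using small PQ P Q by blast+
  have "0 < x ^ k" using sm by simp
  then have N: "N > 0" using sm by linarith
  note eqs = thue_classD(3)[OF S PQ(1)[unfolded P]] thue_classD(3)[OF S PQ(2)[unfolded Q]]
  note dvd = thue_class_dvd[OF S PQ(1,2)[unfolded P Q]]
  have ne: "x * y' \<noteq> x' * y"
  proof
    assume "x * y' = x' * y"
    then have "N * (y' ^ k - y ^ k) = 0" using thue_cross_identity(1)[OF eqs] by simp
    then have "y' ^ k = y ^ k" using N by simp
    then show False using y_ne sm k by (simp add: power_eq_iff_eq_base)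
  qed
  have cube: "u * v \<ge> 0 \<and> (u * v) ^ 3 \<le> N\<^sup>2" if "u > 0" "v > 0" "u ^ k \<le> N" "v ^ k \<le> N" for u v :: int
  proof -
    have "(u * v) ^ 3 \<le> (u * v) ^ k"
      using that k by (intro power_increasing) (auto simp: mult_ge1_I int_one_le_iff_zero_less)
    also have "\<dots> = u ^ k * v ^ k" by (simp add: power_mult_distrib)
    also have "\<dots> \<le> N * N" using that N by (intro mult_mono) auto
    finally show ?thesis using that by (simp add: power2_eq_square)
  qed
  obtain z where z: "z \<ge> 0" "z ^ 3 \<le> N\<^sup>2" "\<bar>x * y' - x' * y\<bar> \<le> z"
  proof (cases "x * y' \<ge> x' * y")
    case True
    then show ?thesis using that[of "x * y'"] cube[of x y'] cube[of x' y] sm by simp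
  next
    case False
    then show ?thesis using that[of "x' * y"] cube[of x y'] cube[of x' y] sm by simp
  qed
  have "N \<le> \<bar>int k * (x * y' - x' * y)\<bar>"
    using dvd ne k by (intro zdvd_imp_le) auto
  also have "\<dots> \<le> int k * z" using z by (simp add: abs_mult mult_left_mono)
  finally have "N ^ 3 \<le> (int k * z) ^ 3" using N by (intro power_mono) auto
  also have "\<dots> \<le> int k ^ 3 * N\<^sup>2" using z by (simp add: power_mult_distrib mult_left_mono)
  finally have N_le: "N \<le> int k ^ 3" using N by (simp add: power3_eq_cube power2_eq_square)
  have "card S = card (snd ` S)"
    using thue_class_inj_snd[OF S] k pos by (intro card_image[symmetric]) auto
  also have "\<dots> \<le> card {1..int k ^ 3}"
  proof (intro card_mono subsetI)
    fix v assume "v \<in> snd ` S"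
    then have "v > 0" "v ^ k \<le> N" using small by auto
    moreover have "v \<le> v ^ k" using k \<open>v > 0\<close> by (intro self_le_power) auto
    ultimately show "v \<in> {1..int k ^ 3}" using N_le by simp
  qed simp
  also have "\<dots> = k ^ 3" by (simp add: nat_power_eq)
  finally show ?thesis .
qed

lemma card_thue_class:
  assumes S: "thue_class k \<rho> \<sigma> N S" and k: "k \<ge> 3" and ne: "\<rho> > 0" "\<sigma> \<noteq> 0" "N \<noteq> 0"
    and fin: "finite S" and H: "\<And>x y. (x, y) \<in> S \<Longrightarrow> real_of_int x \<le> H \<and> real_of_int y \<le> H" "H \<ge> 1"
  shows "real (card S) \<le> real k ^ 3 + log 2 H + 1"
proof -
  have log: "log 2 H \<ge> 0" and k3: "real k ^ 3 \<ge> 0" using H by simp_all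
  consider "\<sigma> < 0" | "\<sigma> > 0" "N > 0" | "\<sigma> > 0" "N < 0" using ne by linarith
  then show ?thesis
  proof cases
    case 1
    then have "real (card S) \<le> real (k ^ 3)"
      using card_thue_class_definite[OF S k ne(1) _ fin] by (simp del: of_nat_power)
    then show ?thesis using log unfolding of_nat_power by linarith
  next
    case 2
    then have "real (card S) \<le> log 2 H + 1"
      using card_thue_class_pos[OF S k ne(1) _ _ fin, of H] H by blast
    then show ?thesis using k3 by linarith
  next
    case 3
    have "real (card (prod.swap ` S)) \<le> log 2 H + 1"
      using card_thue_class_pos[OF thue_class_swap[OF S] k _ ne(1), of H] 3 fin H by auto
    moreover have "card (prod.swap ` S) = card S" by (intro card_image) simp
    ultimately show ?thesis using k3 by linarith
  qed
qed

section \<open>Counting solutions of a binomial Thue equation\<close>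

lemma card_le_card_mult_fiber:
  assumes "finite S" "finite T" "f ` S \<subseteq> T"
    and "\<And>t. t \<in> T \<Longrightarrow> real (card {s \<in> S. f s = t}) \<le> c"
  shows "real (card S) \<le> real (card T) * c"
proof -
  have "S = (\<Union>t\<in>T. {s \<in> S. f s = t})" using assms(3) by auto
  then have "card S \<le> (\<Sum>t\<in>T. card {s \<in> S. f s = t})"
    using card_UN_le[OF assms(2), of "\<lambda>t. {s \<in> S. f s = t}"] by metis
  then have "real (card S) \<le> (\<Sum>t\<in>T. real (card {s \<in> S. f s = t}))"
    unfolding of_nat_sum[symmetric] of_nat_le_iff .
  also have "\<dots> \<le> (\<Sum>t\<in>T. c)" using assms(4) by (intro sum_mono)
  finally show ?thesis by simp
qed

text \<open>
  The residue of \<open>x / y\<close> modulo a prime \<open>p\<close> that does not divide \<open>y\<close>; the first Bezout coefficient of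
  \<open>y\<close> and \<open>p\<close> is an inverse of \<open>y\<close> modulo \<open>p\<close>.
\<close>

definition quot_mod :: "int \<Rightarrow> int \<Rightarrow> int \<Rightarrow> nat" where
  "quot_mod p x y = nat ((x * fst (bezout_coefficients y p)) mod p)"

lemma quot_mod_cong:
  assumes p: "prime p" and y: "\<not> p dvd y"
  shows "[int (quot_mod p x y) * y = x] (mod p)"
proof -
  define u where "u = fst (bezout_coefficients y p)"
  have "coprime y p" using prime_imp_coprime[OF p y] by (simp add: coprime_commute)
  then have "u * y + snd (bezout_coefficients y p) * p = 1"
    unfolding u_def by (simp add: bezout_coefficients_fst_snd)
  then have "[u * y = 1] (mod p)"
    by (metis add_diff_cancel_left' cong_iff_dvd_diff cong_sym dvd_triv_right)
  then have "[x * (u * y) = x * 1] (mod p)" by (rule cong_scalar_left)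
  moreover have "int (quot_mod p x y) = (x * u) mod p"
    unfolding quot_mod_def u_def using p by (simp add: prime_gt_0_int)
  moreover have "[(x * u) mod p * y = x * u * y] (mod p)"
    by (intro cong_scalar_right) (simp add: cong_def)
  ultimately show ?thesis
    using cong_trans[of "(x * u) mod p * y" "x * u * y" p x] by (simp add: mult.assoc)
qed

lemma quot_mod_less: "prime p \<Longrightarrow> quot_mod p x y < nat p"
  using prime_gt_0_int[of p] unfolding quot_mod_def by (simp add: nat_mono_iff)

lemma quot_mod_eq_imp:
  assumes p: "prime p" and y: "\<not> p dvd y" "\<not> p dvd y'" and eq: "quot_mod p x y = quot_mod p x' y'"
  shows "p dvd x * y' - x' * y"
proof -
  define r where "r = int (quot_mod p x y)"
  have 1: "[r * y = x] (mod p)" "[r * y' = x'] (mod p)"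
    using quot_mod_cong[OF p y(1), of x] quot_mod_cong[OF p y(2), of x'] eq unfolding r_def by simp_all
  have "[x * y' = r * y * y'] (mod p)" 
    by (intro cong_scalar_right) (rule cong_sym[OF 1(1)])
  also have "r * y * y' = r * y' * y" by simp
  also have "[r * y' * y = x' * y] (mod p)" using 1(2) by (intro cong_scalar_right)
  finally show ?thesis by (simp add: cong_iff_dvd_diff)
qed

lemma quot_mod_root:
  assumes p: "prime p" and N: "p dvd N" and eq: "\<rho> * x ^ k - \<sigma> * y ^ k = N" and y: "\<not> p dvd y"
  shows "[\<rho> * int (quot_mod p x y) ^ k = \<sigma>] (mod p)"
proof -
  define r where "r = int (quot_mod p x y)"
  have "[(r * y) ^ k = x ^ k] (mod p)"
    using quot_mod_cong[OF p y, of x] unfolding r_def by (rule cong_pow)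
  then have "[\<rho> * (r * y) ^ k = \<rho> * x ^ k] (mod p)" by (rule cong_scalar_left)
  also have "[\<rho> * x ^ k = \<sigma> * y ^ k] (mod p)" using N eq by (simp add: cong_iff_dvd_diff)
  finally have "[(\<rho> * r ^ k) * y ^ k = \<sigma> * y ^ k] (mod p)" by (simp add: power_mult_distrib mult.assoc)
  moreover have "coprime (y ^ k) p"
    using prime_imp_coprime[OF p y] by (simp add: coprime_commute)
  ultimately show ?thesis unfolding r_def by (simp add: cong_mult_rcancel)
qed

text \<open>
  When the two terms are coprime, both are units modulo \<open>N\<close>. Fixing \<open>x / y\<close> modulo each prime
  factor of \<open>N\<close> and \<open>x\<close>, \<open>y\<close> modulo \<open>k ^ 2\<close> then puts solutions into a common \<open>thue_class\<close>. Each
  residue of \<open>x / y\<close> is a \<open>k\<close>-th root of a fixed unit, so there are at most \<open>k\<close> of them for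
  each prime.
\<close>

lemma card_thue_primitive:
  fixes S :: "(int \<times> int) set"
  assumes k: "k \<ge> 3" and ne: "\<rho> > 0" "\<sigma> \<noteq> 0" "N \<noteq> 0" and fin: "finite S"
    and S: "\<And>x y. (x, y) \<in> S \<Longrightarrow> x > 0 \<and> y > 0 \<and> \<rho> * x ^ k - \<sigma> * y ^ k = N
              \<and> coprime (\<rho> * x ^ k) (\<sigma> * y ^ k) \<and> real_of_int x \<le> H \<and> real_of_int y \<le> H"
    and H: "H \<ge> 1"
  shows "real (card S) \<le> real k ^ 4 * real k ^ card (prime_factors N) * (real k ^ 3 + log 2 H + 1)"
proof (cases "S = {}")
  case True
  then show ?thesis using H by simp
next
  case False
  then obtain x0 y0 where xy0: "(x0, y0) \<in> S" by auto
  define PN where "PN = prime_factors N"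
  have PN: "prime p \<and> p dvd N" if "p \<in> PN" for p
    using that unfolding PN_def by auto
  have unit: "\<not> p dvd x \<and> \<not> p dvd y \<and> \<not> p dvd \<rho>" if "p \<in> PN" "(x, y) \<in> S" for p x y
  proof -
    note p = PN[OF that(1)]
    have cop: "coprime (\<rho> * x ^ k) (\<sigma> * y ^ k)" and N: "\<rho> * x ^ k = N + \<sigma> * y ^ k"
      using S[OF that(2)] by auto
    have "p dvd \<rho> * x ^ k \<longleftrightarrow> p dvd \<sigma> * y ^ k"
      using p unfolding N by (simp add: dvd_add_right_iff)
    then have "\<not> p dvd \<rho> * x ^ k" "\<not> p dvd \<sigma> * y ^ k"
      using coprime_common_divisor[OF cop] not_prime_unit p by blast+
    moreover have "k > 0" using k by simp
    ultimately show ?thesis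
      using p by (simp add: prime_dvd_mult_iff prime_dvd_power_iff)
  qed
  define R where "R = (\<lambda>p. {z \<in> {..<nat p}. [z ^ k = quot_mod p x0 y0 ^ k] (mod (nat p))})"
  define K where "K = {0..<(int k)\<^sup>2}"
  \<comment> \<open>\<open>R p\<close> consists of the possible residues of \<open>x / y\<close>: they have the same \<open>k\<close>-th power as that of the base point.\<close>
  define T where "T = (K \<times> K) \<times> PiE PN R"
  define f where "f = (\<lambda>(x, y). ((x mod (int k)\<^sup>2, y mod (int k)\<^sup>2),
                              restrict (\<lambda>p. quot_mod p x y) PN))"
  have finT: "finite T"
    unfolding T_def K_def R_def PN_def by (intro finite_cartesian_product finite_PiE) auto
  have "card T \<le> k ^ 4 * k ^ card PN"
  proof -
    have "card (PiE PN R) = (\<Prod>p\<in>PN. card (R p))"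
      unfolding PN_def by (intro card_PiE) auto
    also have "\<dots> \<le> (\<Prod>p\<in>PN. k)"
    proof (intro prod_mono conjI)
      fix p assume "p \<in> PN"
      then have "prime (nat p)" using PN prime_int_nat_transfer by blast
      then show "card (R p) \<le> k" unfolding R_def using k by (intro roots_mod_prime_bound) auto
    qed auto
    finally have "card (PiE PN R) \<le> k ^ card PN" by simp
    moreover have "card K = k ^ 2" unfolding K_def by (simp flip: of_nat_power)
    ultimately show ?thesis
      unfolding T_def by (simp add: card_cartesian_product eval_nat_numeral)
  qed
  have "f ` S \<subseteq> T"
  proof (rule image_subsetI)
    fix P assume "P \<in> S"
    then obtain x y where P: "P = (x, y)" and xy: "(x, y) \<in> S" by (cases P) auto
    have "quot_mod p x y \<in> R p" if "p \<in> PN" for p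
    proof -
      note p = PN[OF that]
      have "[\<rho> * int (quot_mod p x y) ^ k = \<sigma>] (mod p)" 
           "[\<rho> * int (quot_mod p x0 y0) ^ k = \<sigma>] (mod p)"
        using quot_mod_root[of p N \<rho>] p S[OF xy] S[OF xy0] unit[OF that xy] unit[OF that xy0] by blast+
      then have "[\<rho> * int (quot_mod p x y) ^ k = \<rho> * int (quot_mod p x0 y0) ^ k] (mod p)"
        by (metis cong_sym cong_trans)
      moreover have "coprime \<rho> p"
        using p unit[OF that xy] prime_imp_coprime[of p \<rho>] by (simp add: coprime_commute)
      ultimately have "[int (quot_mod p x y) ^ k = int (quot_mod p x0 y0) ^ k] (mod p)"
        by (simp add: cong_mult_lcancel)
      moreover have "p = int (nat p)" using p by (simp add: prime_ge_0_int)
      ultimately have "[quot_mod p x y ^ k = quot_mod p x0 y0 ^ k] (mod (nat p))"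
        by (metis cong_int_iff of_nat_power)
      then show ?thesis unfolding R_def using quot_mod_less p by simp
    qed
    then show "f P \<in> T" using k unfolding P f_def T_def K_def by auto
  qed
  moreover have "real (card {s \<in> S. f s = t}) \<le> real k ^ 3 + log 2 H + 1" for t
  proof (rule card_thue_class[OF _ k ne _ _ H])
    show "thue_class k \<rho> \<sigma> N {s \<in> S. f s = t}"
    proof -
      have "N dvd int k * (x * y' - x' * y)"
        if xy: "(x, y) \<in> S" "(x', y') \<in> S" and f: "f (x, y) = f (x', y')" for x y x' y'
      proof -
        have "[x = x'] (mod (int k)\<^sup>2)" "[y = y'] (mod (int k)\<^sup>2)"
          using f unfolding f_def cong_def by auto
        then have "[x * y' = x' * y] (mod (int k)\<^sup>2)"
          by (intro cong_mult) (auto intro: cong_sym)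
        then have k2: "(int k)\<^sup>2 dvd x * y' - x' * y" by (simp add: cong_iff_dvd_diff)
        have pr: "p dvd x * y' - x' * y" if "prime p" "p dvd N" for p
        proof -
          have p: "p \<in> PN" using that ne unfolding PN_def by (simp add: in_prime_factors_iff)
          have "restrict (\<lambda>p. quot_mod p x y) PN p = restrict (\<lambda>p. quot_mod p x' y') PN p"
            using f unfolding f_def by simp
          then show ?thesis
            using quot_mod_eq_imp[OF that(1)] unit[OF p xy(1)] unit[OF p xy(2)] p by simp
        qed
        have cop: "coprime (x' * y) N"
        proof (rule ccontr)
          assume "\<not> coprime (x' * y) N"
          then have "\<not> is_unit (gcd (x' * y) N)" "gcd (x' * y) N \<noteq> 0"
            using ne by (simp_all add: coprime_iff_gcd_eq_1)
          then obtain p where p: "prime p" "p dvd gcd (x' * y) N" by (meson prime_divisorE)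
          then have "p \<in> PN" using ne unfolding PN_def by (simp add: in_prime_factors_iff)
          from unit[OF this xy(1)] unit[OF this xy(2)] show False
            using p by (simp add: prime_dvd_mult_iff)
        qed
        note eqs = conjunct1[OF conjunct2[OF conjunct2[OF S[OF xy(1)]]]]
                   conjunct1[OF conjunct2[OF conjunct2[OF S[OF xy(2)]]]]
        have "N dvd \<rho> * ((x * y') ^ k - (x' * y) ^ k)"
          unfolding thue_cross_identity(1)[OF eqs] by simp
        moreover have "coprime \<rho> N"
        proof (rule ccontr)
          assume "\<not> coprime \<rho> N"
          then have "\<not> is_unit (gcd \<rho> N)" "gcd \<rho> N \<noteq> 0"
            using ne by (simp_all add: coprime_iff_gcd_eq_1)
          then obtain p where p: "prime p" "p dvd gcd \<rho> N" by (meson prime_divisorE)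
          then have "p \<in> PN" using ne unfolding PN_def by (simp add: in_prime_factors_iff)
          from unit[OF this xy(1)] show False using p by simp
        qed
        ultimately have "N dvd (x * y') ^ k - (x' * y) ^ k"
          by (simp add: coprime_commute coprime_dvd_mult_right_iff)
        then show ?thesis
          using dvd_power_diff_imp_dvd_diff[of k N "x * y'" "x' * y"] k ne cop pr k2 by auto
      qed
      then show ?thesis unfolding thue_class_def using S by auto
    qed
  qed (use fin S in auto)
  ultimately have "real (card S) \<le> real (card T) * (real k ^ 3 + log 2 H + 1)"
    by (intro card_le_card_mult_fiber[OF fin finT])
  also have "\<dots> \<le> real (k ^ 4 * k ^ card PN) * (real k ^ 3 + log 2 H + 1)"
    using H \<open>card T \<le> _\<close> by (intro mult_right_mono) (simp_all only: of_nat_le_iff, simp)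
  finally show ?thesis unfolding PN_def by simp
qed

text \<open>
  This allows the part of \<open>x\<close> that shares factors with \<open>h\<close> to absorb a common divisor \<open>M\<close> of the
  term \<open>p x\<^sup>k\<close> and \<open>h\<close>.
\<close>

lemma dvd_mult_gcd_power:
  fixes M p x h :: int
  assumes "M dvd p * x ^ k" "M dvd h" "k > 0"
  shows "M dvd p * gcd x h ^ k"
proof -
  have "M dvd h ^ k" using assms by (meson dvd_trans dvd_power)
  then have "M dvd gcd (p * x ^ k) (p * h ^ k)" using assms by (intro gcd_greatest) auto
  also have "gcd (p * x ^ k) (p * h ^ k) = \<bar>p * gcd x h ^ k\<bar>"
    by (simp add: gcd_mult_left gcd_exp abs_mult)
  finally show ?thesis by (simp only: dvd_abs_iff)
qed

text \<open>
  Reduction to the primitive case. With \<open>s = gcd x h\<close>, \<open>u = gcd y h\<close> and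
  \<open>M = gcd (p x\<^sup>k) (q y\<^sup>k)\<close> fixed, the quotients \<open>x / s\<close> and \<open>y / u\<close> solve one and the same primitive
  equation, with coefficients \<open>p s\<^sup>k / M\<close>, \<open>q u\<^sup>k / M\<close> and right-hand side \<open>h / M\<close>. All three
  parameters are divisors of \<open>h\<close>, hence the cube of the number of divisors.
\<close>

lemma card_thue:
  fixes S :: "(int \<times> int) set"
  assumes k: "k \<ge> 3" and ne: "p > 0" "q \<noteq> 0" "h \<noteq> 0" and fin: "finite S"
    and S: "\<And>x y. (x, y) \<in> S \<Longrightarrow> x > 0 \<and> y > 0 \<and> p * x ^ k - q * y ^ k = h
              \<and> real_of_int x \<le> H \<and> real_of_int y \<le> H"
    and H: "H \<ge> 1"
  shows "real (card S) \<le> real (card {d. 0 < d \<and> d dvd h}) ^ 3 *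
           (real k ^ 4 * real k ^ card (prime_factors h) * (real k ^ 3 + log 2 H + 1))"
proof -
  define D where "D = {d. 0 < d \<and> d dvd h}"
  define f where "f = (\<lambda>(x, y). (gcd x h, gcd y h, gcd (p * x ^ k) (q * y ^ k)))"
  define c where "c = real k ^ 4 * real k ^ card (prime_factors h) * (real k ^ 3 + log 2 H + 1)"
  have finD: "finite D"
    using ne unfolding D_def by (rule_tac finite_subset[of _ "{0..\<bar>h\<bar>}"]) (auto dest: dvd_imp_le_int)
  have c0: "c \<ge> 0" unfolding c_def using H by simp
  have "f ` S \<subseteq> D \<times> D \<times> D"
  proof (rule image_subsetI)
    fix P assume "P \<in> S"
    then obtain x y where P: "P = (x, y)" and xy: "(x, y) \<in> S" by (cases P) auto
    have "gcd (p * x ^ k) (q * y ^ k) dvd p * x ^ k - q * y ^ k" by (intro dvd_diff) auto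
    then show "f P \<in> D \<times> D \<times> D"
      using ne S[OF xy] unfolding P f_def D_def by auto
  qed
  moreover have "real (card {s \<in> S. f s = t}) \<le> c" for t
  proof (cases "{s \<in> S. f s = t} = {}")
    case True
    then show ?thesis using c0 unfolding True by simp
  next
    case False
    then obtain x0 y0 where xy0: "(x0, y0) \<in> S" "f (x0, y0) = t" by auto
    define s u M where "s = gcd x0 h" and "u = gcd y0 h" and "M = gcd (p * x0 ^ k) (q * y0 ^ k)"
    have t: "t = (s, u, M)" using xy0 unfolding f_def s_def u_def M_def by simp
    have pos: "s > 0" "u > 0" "M > 0"
      unfolding s_def u_def M_def using S[OF xy0(1)] ne by (auto simp: gcd_pos_int)
    have Mh: "M dvd h" 
    proof -
      have "M dvd p * x0 ^ k - q * y0 ^ k" unfolding M_def by (intro dvd_diff) auto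
      then show ?thesis using S[OF xy0(1)] by simp
    qed
    have "M dvd p * s ^ k" "M dvd q * u ^ k"
      unfolding s_def u_def by (rule dvd_mult_gcd_power[OF _ Mh]; use k in \<open>simp add: M_def\<close>)+
    then obtain \<rho> \<sigma> where \<rho>: "p * s ^ k = M * \<rho>" and \<sigma>: "q * u ^ k = M * \<sigma>" by (elim dvdE)
    obtain N where N: "h = M * N" using Mh by (elim dvdE)
    have "M * \<rho> > 0" unfolding \<rho>[symmetric] using pos ne by simp
    then have "\<rho> > 0" using pos by (simp add: zero_less_mult_iff)
    have "M * \<sigma> \<noteq> 0" unfolding \<sigma>[symmetric] using pos ne by simp
    then have "\<sigma> \<noteq> 0" by simp
    have "N \<noteq> 0" using N ne by simp
    \<comment> \<open>passage to the primitive equation\<close>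
    define g where "g = (\<lambda>(x, y). (x div s, y div u))"
    have fib: "x = s * (x div s) \<and> y = u * (y div u) \<and> gcd (p * x ^ k) (q * y ^ k) = M"
      if "(x, y) \<in> S" "f (x, y) = t" for x y
      using that unfolding t f_def by auto
    have "inj_on g {s \<in> S. f s = t}"
    proof (rule inj_onI)
      fix P Q assume PQ: "P \<in> {s \<in> S. f s = t}" "Q \<in> {s \<in> S. f s = t}" "g P = g Q"
      obtain x y x' y' where P: "P = (x, y)" and Q: "Q = (x', y')" by (metis surj_pair)
      have "x div s = x' div s" "y div u = y' div u" using PQ(3) unfolding P Q g_def by auto
      moreover have "x = s * (x div s)" "y = u * (y div u)" "x' = s * (x' div s)" "y' = u * (y' div u)"
        using fib[of x y] fib[of x' y'] PQ(1,2) unfolding P Q by blast+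
      ultimately have "x = x'" "y = y'" by metis+
      then show "P = Q" unfolding P Q by simp
    qed
    then have "card {s \<in> S. f s = t} = card (g ` {s \<in> S. f s = t})"
      by (simp add: card_image)
    also have "real \<dots> \<le> real k ^ 4 * real k ^ card (prime_factors N) * (real k ^ 3 + log 2 H + 1)"
    proof (rule card_thue_primitive[OF k \<open>\<rho> > 0\<close> \<open>\<sigma> \<noteq> 0\<close> \<open>N \<noteq> 0\<close> _ _ H])
      show "finite (g ` {s \<in> S. f s = t})" using fin by simp
      fix X Y assume "(X, Y) \<in> g ` {s \<in> S. f s = t}"
      then obtain x y where xy: "(x, y) \<in> S" "f (x, y) = t" and XY: "X = x div s" "Y = y div u"
        unfolding g_def by auto
      from fib[OF xy] have x: "x = s * X" and y: "y = u * Y"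
        and gM: "gcd (p * x ^ k) (q * y ^ k) = M" unfolding XY by auto
      have px: "p * x ^ k = M * (\<rho> * X ^ k)" "q * y ^ k = M * (\<sigma> * Y ^ k)"
        unfolding x y using \<rho> \<sigma> by (simp_all add: power_mult_distrib algebra_simps)
      have "M * (\<rho> * X ^ k - \<sigma> * Y ^ k) = M * N"
        using S[OF xy(1)] px N by (simp add: algebra_simps)
      then have 1: "\<rho> * X ^ k - \<sigma> * Y ^ k = N" using pos by simp
      have "M * gcd (\<rho> * X ^ k) (\<sigma> * Y ^ k) = M * 1"
        using gM pos unfolding px by (simp add: gcd_mult_left abs_mult)
      then have 2: "coprime (\<rho> * X ^ k) (\<sigma> * Y ^ k)"
        using pos by (simp add: coprime_iff_gcd_eq_1)
      have 3: "X > 0" "Y > 0" using S[OF xy(1)] pos unfolding x y by (auto simp: zero_less_mult_iff)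
      have "X \<le> x" "Y \<le> y" using 3 pos unfolding x y by simp_all
      then have 4: "real_of_int X \<le> H" "real_of_int Y \<le> H" using S[OF xy(1)] by linarith+
      show "X > 0 \<and> Y > 0 \<and> \<rho> * X ^ k - \<sigma> * Y ^ k = N \<and> coprime (\<rho> * X ^ k) (\<sigma> * Y ^ k)
              \<and> real_of_int X \<le> H \<and> real_of_int Y \<le> H"
        using 1 2 3 4 by blast
    qed
    also have "\<dots> \<le> c"
    proof -
      have "card (prime_factors N) \<le> card (prime_factors h)"
        using N ne by (intro card_mono dvd_prime_factors) auto
      then show ?thesis unfolding c_def using k H
        by (intro mult_right_mono mult_left_mono power_increasing) auto
    qed
    finally show ?thesis .
  qed
  ultimately have "real (card S) \<le> real (card (D \<times> D \<times> D)) * c"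
    by (intro card_le_card_mult_fiber[OF fin]) (use finD in auto)
  then show ?thesis unfolding c_def D_def by (simp add: card_cartesian_product power3_eq_cube)
qed

section \<open>The divisor bound\<close>

lemma card_divisors_le:
  fixes h :: int
  assumes "h \<noteq> 0"
  shows "card {d. 0 < d \<and> d dvd h} \<le> (\<Prod>p\<in>prime_factors h. multiplicity p h + 1)"
proof -
  define f where "f = (\<lambda>d. restrict (\<lambda>p. multiplicity p d) (prime_factors h))"
  have d_eq: "d = (\<Prod>p\<in>prime_factors h. p ^ f d p)" if "0 < d" "d dvd h" for d
  proof -
    have "d = (\<Prod>p\<in>prime_factors d. p ^ multiplicity p d)"
      using that prod_prime_factors[of d] by simp
    also have "\<dots> = (\<Prod>p\<in>prime_factors h. p ^ multiplicity p d)"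
    proof (rule prod.mono_neutral_left)
      show "prime_factors d \<subseteq> prime_factors h"
        using that assms by (intro dvd_prime_factors) auto
      show "\<forall>p\<in>prime_factors h - prime_factors d. p ^ multiplicity p d = 1"
        using that by (auto simp: in_prime_factors_iff not_dvd_imp_multiplicity_0)
    qed auto
    also have "\<dots> = (\<Prod>p\<in>prime_factors h. p ^ f d p)"
      unfolding f_def by (intro prod.cong) auto
    finally show ?thesis .
  qed
  have "inj_on f {d. 0 < d \<and> d dvd h}"
  proof (rule inj_onI)
    fix d d' assume *: "d \<in> {d. 0 < d \<and> d dvd h}" "d' \<in> {d. 0 < d \<and> d dvd h}" "f d = f d'"
    have "d = (\<Prod>p\<in>prime_factors h. p ^ f d p)" using * by (intro d_eq) auto
    also have "\<dots> = d'" unfolding \<open>f d = f d'\<close> using * by (intro d_eq[symmetric]) auto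
    finally show "d = d'" .
  qed
  moreover have "f ` {d. 0 < d \<and> d dvd h} \<subseteq> (\<Pi>\<^sub>E p\<in>prime_factors h. {..multiplicity p h})"
    using assms unfolding f_def by (auto simp: dvd_imp_multiplicity_le)
  ultimately have "card {d. 0 < d \<and> d dvd h} \<le> card (\<Pi>\<^sub>E p\<in>prime_factors h. {..multiplicity p h})"
    by (intro card_inj_on_le finite_PiE) auto
  also have "\<dots> = (\<Prod>p\<in>prime_factors h. multiplicity p h + 1)"
    by (subst card_PiE) auto
  finally show ?thesis .
qed

lemma cube_le_powr:
  assumes "\<epsilon> > 0"
  shows "\<exists>K\<ge>1. \<forall>e::nat. real k * (real e + 1) ^ 3 \<le> K * 2 powr (\<epsilon> * real e)"
proof -
  define c where "c = \<epsilon> * ln 2 / 3"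
  define a where "a = max 1 (1 / c)"
  have c: "c > 0" using assms unfolding c_def by simp
  have a: "a \<ge> 1" "a * c \<ge> 1"
  proof -
    show "a \<ge> 1" unfolding a_def by simp
    have "1 = 1 / c * c" using c by simp
    also have "\<dots> \<le> a * c" unfolding a_def using c by (intro mult_right_mono) auto
    finally show "a * c \<ge> 1" .
  qed
  have "real k * (real e + 1) ^ 3 \<le> (real k * a ^ 3 + 1) * 2 powr (\<epsilon> * real e)" for e
  proof -
    have "1 * real e + 1 \<le> a * c * real e + a" using a by (intro add_mono mult_right_mono) auto
    also have "\<dots> = a * (1 + c * real e)" by (simp add: algebra_simps)
    also have "\<dots> \<le> a * exp (c * real e)" using a by (intro mult_left_mono exp_ge_add_one_self) auto
    finally have "(real e + 1) ^ 3 \<le> (a * exp (c * real e)) ^ 3" by (intro power_mono) auto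
    also have "\<dots> = a ^ 3 * exp (3 * (c * real e))" by (simp add: power_mult_distrib exp_of_nat_mult[of 3, simplified])
    also have "exp (3 * (c * real e)) = 2 powr (\<epsilon> * real e)"
      unfolding c_def powr_def by (simp add: mult_ac)
    finally have "real k * (real e + 1) ^ 3 \<le> real k * (a ^ 3 * 2 powr (\<epsilon> * real e))"
      by (intro mult_left_mono) auto
    also have "\<dots> \<le> (real k * a ^ 3 + 1) * 2 powr (\<epsilon> * real e)"
      by (simp add: algebra_simps)
    finally show ?thesis .
  qed
  moreover have "real k * a ^ 3 + 1 \<ge> 1" using a by simp
  ultimately show ?thesis by blast
qed

text \<open>
  Both factors are multiplicative: the left-hand side is at most the product over the primes
  \<open>p\<close> dividing \<open>h\<close> of the weight \<open>k (e + 1) ^ 3\<close>, where \<open>e\<close> is the multiplicity of \<open>p\<close>. The weight is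
  at most \<open>p\<close> to the power \<open>\<epsilon> e\<close> once \<open>p\<close> is large, and at most a constant multiple of it
  for the boundedly many small primes.
\<close>

lemma divisor_weight_le_powr:
  fixes \<epsilon> :: real
  assumes "\<epsilon> > 0" "k \<ge> 1"
  shows "\<exists>C>0. \<forall>h::int. h \<noteq> 0 \<longrightarrow>
    real (card {d. 0 < d \<and> d dvd h}) ^ 3 * real k ^ card (prime_factors h)
      \<le> C * \<bar>real_of_int h\<bar> powr \<epsilon>"
proof -
  define w where "w = (\<lambda>e::nat. real k * (real e + 1) ^ 3)"
  obtain K where K: "K \<ge> 1" "\<And>e. w e \<le> K * 2 powr (\<epsilon> * real e)"
    using cube_le_powr[OF assms(1), of k] unfolding w_def by blast
  \<comment> \<open>For \<open>e \<ge> 1\<close> the weight is at most \<open>(8 k) ^ e\<close>, so primes above this threshold need no constant.\<close>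
  define B where "B = (8 * real k) powr (1 / \<epsilon>)"
  have large: "w e \<le> (real_of_int p ^ e) powr \<epsilon>" if "real_of_int p > B" "e \<ge> 1" "prime p" for p e
  proof -
    have e2: "real e + 1 \<le> 2 ^ e" using Suc_leI[OF less_exp[of e]]
      by (metis of_nat_Suc of_nat_le_iff of_nat_numeral of_nat_power add.commute)
    have "w e \<le> real k ^ e * (2 ^ e) ^ 3"
      unfolding w_def using assms that e2 by (intro mult_mono power_mono self_le_power) auto
    also have "\<dots> = (8 * real k) ^ e"
    proof -
      have "((2::real) ^ e) ^ 3 = (2 ^ 3) ^ e" by (metis mult.commute power_mult)
      then show ?thesis by (simp add: power_mult_distrib)
    qed
    also have "8 * real k = B powr \<epsilon>" unfolding B_def using assms by (simp add: powr_powr)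
    also have "(B powr \<epsilon>) ^ e \<le> (real_of_int p powr \<epsilon>) ^ e"
      using that assms unfolding B_def by (intro power_mono powr_mono2) auto
    also have "\<dots> = (real_of_int p ^ e) powr \<epsilon>"
      using that prime_gt_0_int[of p] by (simp add: powr_powr mult.commute flip: powr_realpow)
    finally show ?thesis .
  qed
  have small: "w e \<le> K * (real_of_int p ^ e) powr \<epsilon>" if "prime p" for p e
  proof -
    have "w e \<le> K * 2 powr (\<epsilon> * real e)" by (rule K)
    also have "2 powr (\<epsilon> * real e) = (2 ^ e) powr \<epsilon>"
      by (simp add: powr_powr mult.commute flip: powr_realpow)
    also have "K * (2 ^ e) powr \<epsilon> \<le> K * (real_of_int p ^ e) powr \<epsilon>"
      using K(1) assms prime_ge_2_int[OF that]
      by (intro mult_left_mono powr_mono2 power_mono) auto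
    finally show ?thesis .
  qed
  define m where "m = nat \<lfloor>B\<rfloor>"
  have "real (card {d. 0 < d \<and> d dvd h}) ^ 3 * real k ^ card (prime_factors h)
      \<le> K ^ m * \<bar>real_of_int h\<bar> powr \<epsilon>" if h: "h \<noteq> 0" for h :: int
  proof -
    define P where "P = prime_factors h"
    have P: "finite P" "\<And>p. p \<in> P \<Longrightarrow> prime p \<and> multiplicity p h \<ge> 1"
      unfolding P_def using h
      by (auto simp: in_prime_factors_iff prime_multiplicity_gt_zero_iff Suc_le_eq)
    have "real (card {d. 0 < d \<and> d dvd h}) ^ 3 * real k ^ card P
        \<le> real (\<Prod>p\<in>P. multiplicity p h + 1) ^ 3 * real k ^ card P"
      using card_divisors_le[OF h] unfolding P_def
      by (intro mult_right_mono power_mono) (simp_all only: of_nat_le_iff, auto)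
    also have "\<dots> = (\<Prod>p\<in>P. w (multiplicity p h))"
      unfolding w_def by (simp add: prod.distrib prod_power_distrib mult.commute add.commute)
    also have "\<dots> \<le> (\<Prod>p\<in>P. (if real_of_int p \<le> B then K else 1) * (real_of_int p ^ multiplicity p h) powr \<epsilon>)"
    proof (intro prod_mono conjI)
      fix p assume "p \<in> P"
      then show "w (multiplicity p h) \<le>
          (if real_of_int p \<le> B then K else 1) * (real_of_int p ^ multiplicity p h) powr \<epsilon>"
        using P(2) small large by auto
    qed (simp add: w_def)
    also have "\<dots> = (\<Prod>p\<in>P. if real_of_int p \<le> B then K else 1)
                  * (\<Prod>p\<in>P. (real_of_int p ^ multiplicity p h) powr \<epsilon>)"
      by (rule prod.distrib)
    also have "(\<Prod>p\<in>P. if real_of_int p \<le> B then K else 1) = K ^ card {p \<in> P. real_of_int p \<le> B}"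
      using P(1) by (simp add: prod.If_cases Int_def)
    also have "(\<Prod>p\<in>P. (real_of_int p ^ multiplicity p h) powr \<epsilon>)
             = (\<Prod>p\<in>P. real_of_int p ^ multiplicity p h) powr \<epsilon>"
      by (rule prod_powr_distrib[symmetric])
    also have "(\<Prod>p\<in>P. real_of_int p ^ multiplicity p h) = \<bar>real_of_int h\<bar>"
    proof -
      have "(\<Prod>p\<in>P. p ^ multiplicity p h) = \<bar>h\<bar>"
        unfolding P_def using prod_prime_factors[OF h] by simp
      then have "real_of_int (\<Prod>p\<in>P. p ^ multiplicity p h) = real_of_int \<bar>h\<bar>" by simp
      then show ?thesis by simp
    qed
    also have "K ^ card {p \<in> P. real_of_int p \<le> B} * \<bar>real_of_int h\<bar> powr \<epsilon> \<le> K ^ m * \<bar>real_of_int h\<bar> powr \<epsilon>"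
    proof (intro mult_right_mono power_increasing)
      have "card {p \<in> P. real_of_int p \<le> B} \<le> card {1..\<lfloor>B\<rfloor>}"
        using P(2) prime_ge_1_int by (intro card_mono) (fastforce simp: le_floor_iff)+
      then show "card {p \<in> P. real_of_int p \<le> B} \<le> m" unfolding m_def by simp
    qed (use K in auto)
    finally show ?thesis unfolding P_def .
  qed
  moreover have "K ^ m > 0" using K by simp
  ultimately show ?thesis by blast
qed

section \<open>Tuples of polynomial size\<close>

text \<open>
  When \<open>h\<close>, \<open>x\<close> and \<open>y\<close> are bounded by powers of \<open>m\<close>, half of \<open>\<epsilon>\<close> pays for the number of
  classes and the other half for the logarithmic size of a class.
\<close>

lemma card_thue_le_powr:
  fixes \<epsilon> V :: real
  assumes k: "k \<ge> 3" and \<epsilon>: "\<epsilon> > 0" and V: "V \<ge> 0"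
  shows "\<exists>C>0. \<forall>(p::int) q h m S. p > 0 \<longrightarrow> q \<noteq> 0 \<longrightarrow> h \<noteq> 0 \<longrightarrow> 1 \<le> m \<longrightarrow> finite S \<longrightarrow>
     ln \<bar>real_of_int h\<bar> \<le> V * (1 + ln m) \<longrightarrow>
     (\<forall>(x, y)\<in>S. x > 0 \<and> y > 0 \<and> p * x ^ k - q * y ^ k = h \<and>
        ln (real_of_int x) \<le> V * (1 + ln m) \<and> ln (real_of_int y) \<le> V * (1 + ln m)) \<longrightarrow>
     real (card S) \<le> C * m powr \<epsilon>"
proof -
  \<comment> \<open>chosen so that \<open>|h| powr \<delta>\<close> is at most a constant times \<open>m powr (\<epsilon> / 2)\<close>\<close>
  define \<delta> where "\<delta> = \<epsilon> / (2 * (V + 1))"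
  have \<delta>: "\<delta> > 0" "\<delta> * V \<le> \<epsilon> / 2" unfolding \<delta>_def using \<epsilon> V by (simp_all add: field_simps)
  obtain C0 where C0: "C0 > 0" "\<And>h::int. h \<noteq> 0 \<Longrightarrow>
     real (card {d. 0 < d \<and> d dvd h}) ^ 3 * real k ^ card (prime_factors h) \<le> C0 * \<bar>real_of_int h\<bar> powr \<delta>"
    using divisor_weight_le_powr[OF \<delta>(1), of k] k by auto
  define L where "L = real k ^ 3 + V / ln 2 + 1"
  have L: "L \<ge> 1" unfolding L_def using V by simp
  define C where "C = (C0 * exp (\<epsilon> / 2)) * (real k ^ 4 * (L * (1 + 2 / \<epsilon>)))"
  have "real (card S) \<le> C * m powr \<epsilon>"
    if h: "p > 0" "q \<noteq> 0" "h \<noteq> 0" "1 \<le> m" "finite S" "ln \<bar>real_of_int h\<bar> \<le> V * (1 + ln m)"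
      and S: "\<forall>(x, y)\<in>S. x > 0 \<and> y > 0 \<and> p * x ^ k - q * y ^ k = h \<and>
        ln (real_of_int x) \<le> V * (1 + ln m) \<and> ln (real_of_int y) \<le> V * (1 + ln m)"
    for p q h :: int and m and S
  proof -
    define H where "H = exp (V * (1 + ln m))"
    have lm: "ln m \<ge> 0" using h by simp
    have H: "H \<ge> 1" unfolding H_def using V lm by simp
    have "real (card S) \<le> real (card {d. 0 < d \<and> d dvd h}) ^ 3 *
           (real k ^ 4 * real k ^ card (prime_factors h) * (real k ^ 3 + log 2 H + 1))"
    proof (rule card_thue[OF k h(1,2,3,5) _ H])
      fix x y assume "(x, y) \<in> S"
      with S have *: "x > 0" "y > 0" "p * x ^ k - q * y ^ k = h"
        "ln (real_of_int x) \<le> V * (1 + ln m)" "ln (real_of_int y) \<le> V * (1 + ln m)" by auto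
      have "real_of_int x \<le> H" "real_of_int y \<le> H"
        unfolding H_def using * by (metis exp_le_cancel_iff exp_ln of_int_0_less_iff)+
      then show "x > 0 \<and> y > 0 \<and> p * x ^ k - q * y ^ k = h \<and> real_of_int x \<le> H \<and> real_of_int y \<le> H"
        using * by simp
    qed
    also have "\<dots> = (real (card {d. 0 < d \<and> d dvd h}) ^ 3 * real k ^ card (prime_factors h)) *
           (real k ^ 4 * (real k ^ 3 + log 2 H + 1))" by simp
    also have "\<dots> \<le> (C0 * exp (\<epsilon> / 2) * m powr (\<epsilon> / 2)) * (real k ^ 4 * (L * (1 + 2 / \<epsilon>) * m powr (\<epsilon> / 2)))"
    proof (rule mult_mono)
      have "\<bar>real_of_int h\<bar> powr \<delta> = exp (\<delta> * ln \<bar>real_of_int h\<bar>)" using h by (simp add: powr_def)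
      also have "\<delta> * ln \<bar>real_of_int h\<bar> \<le> \<delta> * (V * (1 + ln m))" using h(6) \<delta> by (intro mult_left_mono) auto
      also have "\<dots> = (\<delta> * V) * (1 + ln m)" by simp
      also have "\<dots> \<le> \<epsilon> / 2 * (1 + ln m)" using \<delta> lm by (intro mult_right_mono) auto
      also have "exp (\<epsilon> / 2 * (1 + ln m)) = exp (\<epsilon> / 2) * m powr (\<epsilon> / 2)"
        using h by (simp add: powr_def exp_add distrib_left)
      finally have "\<bar>real_of_int h\<bar> powr \<delta> \<le> exp (\<epsilon> / 2) * m powr (\<epsilon> / 2)" by simp
      then have "C0 * \<bar>real_of_int h\<bar> powr \<delta> \<le> C0 * (exp (\<epsilon> / 2) * m powr (\<epsilon> / 2))"
        using C0(1) by (intro mult_left_mono) auto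
      then show "real (card {d. 0 < d \<and> d dvd h}) ^ 3 * real k ^ card (prime_factors h)
          \<le> C0 * exp (\<epsilon> / 2) * m powr (\<epsilon> / 2)"
        using C0(2)[OF h(3)] by simp
      have "real k ^ 3 + log 2 H + 1 = real k ^ 3 + 1 + V / ln 2 * (1 + ln m)"
        unfolding H_def log_def by simp
      also have "\<dots> \<le> (real k ^ 3 + 1) * (1 + ln m) + V / ln 2 * (1 + ln m)"
        using lm mult_left_mono[of 1 "1 + ln m" "real k ^ 3 + 1"] by simp
      also have "\<dots> = L * (1 + ln m)" unfolding L_def by (simp add: algebra_simps)
      also have "\<dots> \<le> L * ((1 + 2 / \<epsilon>) * m powr (\<epsilon> / 2))"
      proof (intro mult_left_mono)
        have "\<epsilon> / 2 * ln m \<le> exp (\<epsilon> / 2 * ln m)"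
          using exp_ge_add_one_self[of "\<epsilon> / 2 * ln m"] by linarith
        then have "ln m \<le> 2 / \<epsilon> * m powr (\<epsilon> / 2)"
          using \<epsilon> h by (simp add: powr_def field_simps)
        moreover have "1 \<le> m powr (\<epsilon> / 2)" using h \<epsilon> by (simp add: ge_one_powr_ge_zero)
        ultimately show "1 + ln m \<le> (1 + 2 / \<epsilon>) * m powr (\<epsilon> / 2)" by (simp add: algebra_simps)
      qed (use L in auto)
      finally have "real k ^ 3 + log 2 H + 1 \<le> L * (1 + 2 / \<epsilon>) * m powr (\<epsilon> / 2)" by simp
      then show "real k ^ 4 * (real k ^ 3 + log 2 H + 1) \<le> real k ^ 4 * (L * (1 + 2 / \<epsilon>) * m powr (\<epsilon> / 2))"
        by (intro mult_left_mono) auto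
    qed (use C0 H in \<open>auto intro!: mult_nonneg_nonneg add_nonneg_nonneg\<close>)
    also have "\<dots> = C * (m powr (\<epsilon> / 2) * m powr (\<epsilon> / 2))" unfolding C_def by simp
    also have "m powr (\<epsilon> / 2) * m powr (\<epsilon> / 2) = m powr \<epsilon>" by (simp flip: powr_add)
    finally show ?thesis .
  qed
  moreover have "C > 0" unfolding C_def using C0 L \<epsilon> k by (intro mult_pos_pos) (auto intro: add_pos_pos)
  ultimately show ?thesis by blast
qed

lemma ln_of_int_mono: "0 < u \<Longrightarrow> u \<le> v \<Longrightarrow> ln (real_of_int u) \<le> ln (real_of_int v)"
  by simp

lemma nth_power_abs_root:
  fixes z :: int
  assumes "is_nth_power k z" "z \<noteq> 0" "k > 0"
  shows "\<exists>x>0. \<bar>z\<bar> = x ^ k"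
proof -
  from assms(1) obtain x where x: "z = x ^ k" by (elim is_nth_powerE)
  then have "\<bar>z\<bar> = \<bar>x\<bar> ^ k" by (simp add: power_abs)
  moreover have "x \<noteq> 0" using x assms by (auto simp: power_0_left)
  ultimately show ?thesis by (intro exI[of _ "\<bar>x\<bar>"]) simp
qed

text \<open>
  The element \<open>b\<close> is recovered from the roots of \<open>|a b + n|\<close> and \<open>|a' b + n|\<close> once the signs of
  these numbers are known. Each of the four choices of signs leads to one Thue equation with coefficients
  \<open>a'\<close> and \<open>\<plusminus>a\<close> and right-hand side \<open>\<plusminus>n (a' - a)\<close>; vanishing values account for at most two further elements.
\<close>

lemma card_common_powers_le:
  fixes \<epsilon> V :: real
  assumes k: "k \<ge> 3" and \<epsilon>: "\<epsilon> > 0" and V: "V \<ge> 0"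
  shows "\<exists>C>0. \<forall>(a::int) a' n B. 0 < a \<longrightarrow> a < a' \<longrightarrow> n \<noteq> 0 \<longrightarrow>
     (\<forall>b\<in>B. b > 0 \<and> is_nth_power k (a * b + n) \<and> is_nth_power k (a' * b + n)
          \<and> ln (real_of_int b) \<le> V * (1 + ln \<bar>real_of_int n\<bar>)) \<longrightarrow>
     ln (real_of_int a') \<le> V * (1 + ln \<bar>real_of_int n\<bar>) \<longrightarrow>
     finite B \<and> real (card B) \<le> C * \<bar>real_of_int n\<bar> powr \<epsilon>"
proof -
  \<comment> \<open>The roots are at most \<open>2 a' b |n|\<close>, and \<open>a'\<close> and \<open>b\<close> contribute \<open>V\<close> each.\<close>
  define W where "W = 2 * V + 2"
  obtain C where C: "C > 0" "\<And>(p::int) q h m S. p > 0 \<Longrightarrow> q \<noteq> 0 \<Longrightarrow> h \<noteq> 0 \<Longrightarrow> 1 \<le> m \<Longrightarrow> finite S \<Longrightarrow>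
     ln \<bar>real_of_int h\<bar> \<le> W * (1 + ln m) \<Longrightarrow>
     (\<forall>(x, y)\<in>S. x > 0 \<and> y > 0 \<and> p * x ^ k - q * y ^ k = h \<and>
        ln (real_of_int x) \<le> W * (1 + ln m) \<and> ln (real_of_int y) \<le> W * (1 + ln m)) \<Longrightarrow>
     real (card S) \<le> C * m powr \<epsilon>"
    using card_thue_le_powr[OF k \<epsilon>, of W] V unfolding W_def by auto
  have main: "finite B \<and> real (card B) \<le> (2 + 4 * C) * \<bar>real_of_int n\<bar> powr \<epsilon>"
    if a: "0 < a" "a < a'" "n \<noteq> 0" and B: "\<And>b. b \<in> B \<Longrightarrow> b > 0 \<and> is_nth_power k (a * b + n)
         \<and> is_nth_power k (a' * b + n) \<and> ln (real_of_int b) \<le> V * (1 + ln \<bar>real_of_int n\<bar>)"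
      and la': "ln (real_of_int a') \<le> V * (1 + ln \<bar>real_of_int n\<bar>)" for a a' n B
  proof -
    define m where "m = \<bar>real_of_int n\<bar>"
    have m: "m \<ge> 1" unfolding m_def using a(3) by linarith
    then have lm: "ln m \<ge> 0" by simp
    have fin: "finite B"
    proof (rule finite_subset)
      show "B \<subseteq> {0..\<lfloor>exp (V * (1 + ln m))\<rfloor>}"
      proof
        fix b assume "b \<in> B"
        then have b: "b > 0" "ln (real_of_int b) \<le> V * (1 + ln m)" using B unfolding m_def by auto
        then have "real_of_int b \<le> exp (V * (1 + ln m))"
          by (metis exp_le_cancel_iff exp_ln of_int_0_less_iff)
        then show "b \<in> {0..\<lfloor>exp (V * (1 + ln m))\<rfloor>}" using b by (simp add: le_floor_iff)
      qed
    qed simp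
    define sg where "sg = (\<lambda>s s'. {b \<in> B. s * (a * b + n) > 0 \<and> s' * (a' * b + n) > 0})"
    have sg_card: "real (card (sg s s')) \<le> C * m powr \<epsilon>" if s: "s \<in> {1, -1}" "s' \<in> {1, -1}" for s s'
    proof -
      have "\<exists>x>0. s * (a * b + n) = x ^ k" "\<exists>y>0. s' * (a' * b + n) = y ^ k" if b: "b \<in> sg s s'" for b
      proof -
        have "\<bar>a * b + n\<bar> = s * (a * b + n)" "\<bar>a' * b + n\<bar> = s' * (a' * b + n)"
          "a * b + n \<noteq> 0" "a' * b + n \<noteq> 0"
          using b s unfolding sg_def by auto
        moreover have "is_nth_power k (a * b + n)" "is_nth_power k (a' * b + n)"
          using B b unfolding sg_def by blast+
        moreover have "k > 0" using k by simp
        ultimately show "\<exists>x>0. s * (a * b + n) = x ^ k" "\<exists>y>0. s' * (a' * b + n) = y ^ k"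
          using nth_power_abs_root by metis+
      qed
      then obtain x y where xy: "\<And>b. b \<in> sg s s' \<Longrightarrow> x b > 0 \<and> s * (a * b + n) = x b ^ k"
        "\<And>b. b \<in> sg s s' \<Longrightarrow> y b > 0 \<and> s' * (a' * b + n) = y b ^ k"
        by metis
      define f where "f = (\<lambda>b. (x b, y b))"
      have "inj_on f (sg s s')"
      proof (rule inj_onI)
        fix b c assume bc: "b \<in> sg s s'" "c \<in> sg s s'" "f b = f c"
        then have "s * (a * b + n) = s * (a * c + n)" using xy(1) unfolding f_def by (metis prod.inject)
        then show "b = c" using s a by auto
      qed
      then have "card (sg s s') = card (f ` sg s s')" by (simp add: card_image)
      also have "real \<dots> \<le> C * m powr \<epsilon>"
      proof (rule C(2))
        show "a' > 0" using a by simp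
        show "s * s' * a \<noteq> 0" "s * n * (a' - a) \<noteq> 0" using s a by auto
        show "1 \<le> m" by (rule m)
        show "finite (f ` sg s s')" using fin unfolding sg_def by simp
        have "\<bar>s * n * (a' - a)\<bar> \<le> \<bar>n\<bar> * a'" using s a by (auto simp: abs_mult intro!: mult_left_mono)
        then have "ln (real_of_int \<bar>s * n * (a' - a)\<bar>) \<le> ln (real_of_int (\<bar>n\<bar> * a'))"
          using s a by (intro ln_of_int_mono) auto
        also have "\<dots> = ln m + ln (real_of_int a')" using a unfolding m_def by (simp add: ln_mult)
        also have "\<dots> \<le> (1 + ln m) + V * (1 + ln m)" using la' unfolding m_def by simp
        also have "\<dots> \<le> W * (1 + ln m)" unfolding W_def using V lm by (simp add: algebra_simps)
        finally show "ln \<bar>real_of_int (s * n * (a' - a))\<bar> \<le> W * (1 + ln m)" by simp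
        have bd: "ln (real_of_int u) \<le> W * (1 + ln m)"
          if b: "b \<in> sg s s'" and u: "u > 0" "t * (c * b + n) = u ^ k" "t \<in> {1, -1}" "0 < c" "c \<le> a'" for b u t c
        proof -
          have b0: "b > 0" "ln (real_of_int b) \<le> V * (1 + ln m)" using b B unfolding sg_def m_def by auto
          have "u \<le> u ^ k" using u k by (intro self_le_power) auto
          also have "\<dots> \<le> \<bar>c * b + n\<bar>" unfolding u(2)[symmetric] using u(3) by auto
          also have "\<dots> \<le> c * b + \<bar>n\<bar>" using u b0 abs_triangle_ineq[of "c * b" n] by simp
          also have "\<dots> \<le> a' * b + \<bar>n\<bar>" using u b0 by simp
          also have "\<dots> \<le> 2 * (a' * b * \<bar>n\<bar>)"
          proof -
            have "1 \<le> a' * b" "1 \<le> \<bar>n\<bar>" using a b0 mult_pos_pos[of a' b] by linarith+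
            then have "a' * b * 1 \<le> a' * b * \<bar>n\<bar>" "1 * \<bar>n\<bar> \<le> a' * b * \<bar>n\<bar>"
              using mult_left_mono[of 1 "\<bar>n\<bar>" "a' * b"] mult_right_mono[of 1 "a' * b" "\<bar>n\<bar>"] by linarith+
            then show ?thesis by linarith
          qed
          finally have "ln (real_of_int u) \<le> ln (real_of_int (2 * (a' * b * \<bar>n\<bar>)))"
            using u by (intro ln_of_int_mono) auto
          also have "\<dots> = ln 2 + ln (real_of_int a') + ln (real_of_int b) + ln m"
            using a b0 unfolding m_def by (simp add: ln_mult)
          also have "\<dots> \<le> 1 + V * (1 + ln m) + V * (1 + ln m) + ln m"
            using la' b0 ln_2_less_1 unfolding m_def by linarith
          also have "\<dots> \<le> W * (1 + ln m)" unfolding W_def using V lm by (simp add: algebra_simps)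
          finally show ?thesis .
        qed
        have "x b > 0 \<and> y b > 0 \<and> a' * x b ^ k - s * s' * a * y b ^ k = s * n * (a' - a) \<and>
          ln (real_of_int (x b)) \<le> W * (1 + ln m) \<and> ln (real_of_int (y b)) \<le> W * (1 + ln m)"
          if b: "b \<in> sg s s'" for b
        proof (intro conjI)
          show "x b > 0" "y b > 0" using xy b by blast+
          show "ln (real_of_int (x b)) \<le> W * (1 + ln m)"
            using bd[OF b, of "x b" s a] xy(1)[OF b] s a by auto
          show "ln (real_of_int (y b)) \<le> W * (1 + ln m)"
            using bd[OF b, of "y b" s' a'] xy(2)[OF b] s a by auto
          have "a' * x b ^ k - s * s' * a * y b ^ k = a' * (s * (a * b + n)) - s * s' * a * (s' * (a' * b + n))"
            using xy b by metis
          also have "\<dots> = s * n * (a' - a)" using s by (auto simp: algebra_simps)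
          finally show "a' * x b ^ k - s * s' * a * y b ^ k = s * n * (a' - a)" .
        qed
        then show "\<forall>(x, y)\<in>f ` sg s s'. x > 0 \<and> y > 0 \<and> a' * x ^ k - s * s' * a * y ^ k = s * n * (a' - a) \<and>
          ln (real_of_int x) \<le> W * (1 + ln m) \<and> ln (real_of_int y) \<le> W * (1 + ln m)"
          unfolding f_def by auto
      qed
      finally show ?thesis .
    qed
    define Z where "Z = {b \<in> B. a * b + n = 0} \<union> {b \<in> B. a' * b + n = 0}"
    have cZ: "card Z \<le> 2"
    proof -
      have 1: "card {b \<in> B. c * b + n = 0} \<le> 1" if "c > 0" for c
      proof -
        have "c * b = c * b'" if "c * b + n = 0" "c * b' + n = 0" for b b' using that by linarith
        then have "b = b'" if "c * b + n = 0" "c * b' + n = 0" for b b' using that \<open>c > 0\<close> by auto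
        then show ?thesis using fin by (intro card_le_Suc0_iff_eq[THEN iffD2, folded One_nat_def]) auto
      qed
      have "card Z \<le> card {b \<in> B. a * b + n = 0} + card {b \<in> B. a' * b + n = 0}"
        unfolding Z_def by (rule card_Un_le)
      also have "\<dots> \<le> 1 + 1" using a by (intro add_mono 1) auto
      finally show ?thesis by simp
    qed
    have "B \<subseteq> Z \<union> (sg 1 1 \<union> (sg 1 (-1) \<union> (sg (-1) 1 \<union> sg (-1) (-1))))"
      unfolding Z_def sg_def by auto
    then have "card B \<le> card (Z \<union> (sg 1 1 \<union> (sg 1 (-1) \<union> (sg (-1) 1 \<union> sg (-1) (-1)))))"
      using fin by (intro card_mono) (auto simp: Z_def sg_def)
    also have "\<dots> \<le> card Z + (card (sg 1 1) + (card (sg 1 (-1)) + (card (sg (-1) 1) + card (sg (-1) (-1)))))"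
      by (intro order_trans[OF card_Un_le] add_left_mono order_refl)
    finally have "real (card B) \<le> real (card Z) + (card (sg 1 1) + (card (sg 1 (-1)) + (card (sg (-1) 1) + card (sg (-1) (-1)))))"
      by (metis of_nat_add of_nat_le_iff)
    also have "\<dots> \<le> 2 * m powr \<epsilon> + 4 * (C * m powr \<epsilon>)"
    proof -
      have "1 \<le> m powr \<epsilon>" using m \<epsilon> by (simp add: ge_one_powr_ge_zero)
      moreover have "real (card Z) \<le> 2" using cZ by simp
      ultimately have "real (card Z) \<le> 2 * m powr \<epsilon>" by linarith
      then show ?thesis
        using sg_card[of 1 1] sg_card[of 1 "-1"] sg_card[of "-1" 1] sg_card[of "-1" "-1"] by simp
    qed
    finally show ?thesis using fin unfolding m_def by (simp add: algebra_simps)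
  qed
  have "2 + 4 * C > 0" using C(1) by simp
  moreover have "finite B \<and> real (card B) \<le> (2 + 4 * C) * \<bar>real_of_int n\<bar> powr \<epsilon>"
    if "0 < a" "a < a'" "n \<noteq> 0" "\<forall>b\<in>B. b > 0 \<and> is_nth_power k (a * b + n) \<and> is_nth_power k (a' * b + n)
          \<and> ln (real_of_int b) \<le> V * (1 + ln \<bar>real_of_int n\<bar>)"
      "ln (real_of_int a') \<le> V * (1 + ln \<bar>real_of_int n\<bar>)" for a a' n B
    by (rule main[OF that(1-3) bspec[OF that(4)] that(5)])
  ultimately show ?thesis by (intro exI[of _ "2 + 4 * C"]) simp
qed

section \<open>The ABC conjecture and the gap principle\<close>

lemma rad_le:
  assumes W: "W \<noteq> 0" and pr: "\<And>p. prime p \<Longrightarrow> p dvd Z \<Longrightarrow> p dvd W"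
  shows "1 \<le> rad Z" "rad Z \<le> \<bar>W\<bar>"
proof -
  have ge1: "1 \<le> p" if "prime p" for p :: int using prime_ge_1_int[OF that] .
  show "1 \<le> rad Z" unfolding rad_def by (intro prod_ge_1) (auto dest: ge1)
  have "rad Z \<le> (\<Prod>p\<in>prime_factors W. p)"
    unfolding rad_def
  proof (rule prod_mono2)
    show "{p. prime p \<and> p dvd Z} \<subseteq> prime_factors W"
      using pr W by (auto simp: in_prime_factors_iff)
  qed (auto simp: in_prime_factors_iff dest: ge1 prime_ge_0_int)
  also have "\<dots> \<le> (\<Prod>p\<in>prime_factors W. p ^ multiplicity p W)"
  proof (intro prod_mono conjI)
    fix p assume p: "p \<in> prime_factors W"
    then show "0 \<le> p" by (auto dest: prime_ge_0_int)
    show "p \<le> p ^ multiplicity p W"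
      using p W by (intro self_le_power ge1)
        (auto simp: in_prime_factors_iff prime_multiplicity_gt_zero_iff)
  qed
  also have "\<dots> = \<bar>W\<bar>" using prod_prime_factors[OF W] by simp
  finally show "rad Z \<le> \<bar>W\<bar>" .
qed

text \<open>
  ABC for the triple obtained by dividing the three terms by the common divisor \<open>M\<close> of the first two. The
  radical is at most \<open>p q x y |h| / M\<close>, and multiplying back by \<open>M\<close> costs nothing as the exponent
  is at least \<open>1\<close>.
\<close>

lemma abc_thue:
  assumes abc: "ABC_conjecture" and \<eta>: "\<eta> > 0"
  shows "\<exists>K\<ge>1. \<forall>(p::int) q x y h k. p > 0 \<longrightarrow> q > 0 \<longrightarrow> x > 0 \<longrightarrow> y > 0 \<longrightarrow> h \<noteq> 0 \<longrightarrow> 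
    p * x ^ k - q * y ^ k = h \<longrightarrow>
      real_of_int (p * x ^ k) \<le> K * real_of_int (p * q * x * y * \<bar>h\<bar>) powr (1 + \<eta>)"
proof -
  obtain K0 where K0: "\<And>a b c :: int. a \<noteq> 0 \<Longrightarrow> b \<noteq> 0 \<Longrightarrow> c \<noteq> 0 \<Longrightarrow> gcd a (gcd b c) = 1 \<Longrightarrow> a + b = c \<Longrightarrow>
          real_of_int (Max {\<bar>a\<bar>, \<bar>b\<bar>, \<bar>c\<bar>}) \<le> K0 * real_of_int (rad (a * b * c)) powr (1 + \<eta>)"
    using abc \<eta> unfolding ABC_conjecture_def by blast
  define K where "K = max K0 1"
  have "real_of_int (p * x ^ k) \<le> K * real_of_int (p * q * x * y * \<bar>h\<bar>) powr (1 + \<eta>)"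
    if pos: "p > 0" "q > 0" "x > 0" "y > 0" "h \<noteq> 0" and eq: "p * x ^ k - q * y ^ k = h"
    for p q x y h :: int and k :: nat
  proof -
    define M where "M = gcd (p * x ^ k) (q * y ^ k)"
    have Mpos: "M > 0" unfolding M_def using pos by (auto simp: gcd_pos_int)
    have "M dvd p * x ^ k" "M dvd q * y ^ k" unfolding M_def by simp_all
    then obtain c b where c: "p * x ^ k = M * c" and b: "q * y ^ k = M * b" by (elim dvdE)
    define a where "a = c - b"
    have h: "h = M * a" unfolding a_def using eq c b by (simp add: algebra_simps)
    have "M * gcd c b = M * 1"
      using Mpos M_def unfolding c b by (simp add: gcd_mult_left abs_mult)
    then have g: "gcd c b = 1" using Mpos by simp
    have "M * c > 0" "M * b > 0" unfolding c[symmetric] b[symmetric] using pos by simp_all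
    then have cb: "c > 0" "b > 0" using Mpos by (simp_all add: zero_less_mult_iff)
    have a0: "a \<noteq> 0" using h pos by auto
    define W where "W = p * q * x * y * a"
    have W0: "W \<noteq> 0" unfolding W_def using pos a0 by simp
    have pW: "r dvd W" if r: "prime r" "r dvd a * b * c" for r
    proof -
      have "r dvd a \<or> r dvd q * y ^ k \<or> r dvd p * x ^ k"
        using r unfolding c b by (auto simp: prime_dvd_mult_iff)
      then have "r dvd a \<or> r dvd q \<or> r dvd y \<or> r dvd p \<or> r dvd x"
        using r by (auto simp: prime_dvd_mult_iff dest: prime_dvd_power)
      then show ?thesis unfolding W_def using r by (auto simp: prime_dvd_mult_iff)
    qed
    have rad: "1 \<le> rad (a * b * c)" "rad (a * b * c) \<le> \<bar>W\<bar>"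
      using rad_le[OF W0 pW] by blast+
    then have rad': "0 \<le> real_of_int (rad (a * b * c))" "real_of_int (rad (a * b * c)) \<le> real_of_int \<bar>W\<bar>"
      by linarith+
    have "real_of_int c \<le> real_of_int (Max {\<bar>a\<bar>, \<bar>b\<bar>, \<bar>c\<bar>})" using cb by simp
    also have "\<dots> \<le> K0 * real_of_int (rad (a * b * c)) powr (1 + \<eta>)"
      by (rule K0) (use a0 cb g in \<open>auto simp: a_def gcd.commute[of b c]\<close>)
    also have "\<dots> \<le> K * real_of_int \<bar>W\<bar> powr (1 + \<eta>)"
      using rad' \<eta> by (intro mult_mono powr_mono2) (auto simp: K_def)
    also have "\<dots> \<le> K * (real_of_int (p * q * x * y * \<bar>h\<bar>) / M) powr (1 + \<eta>)"
    proof -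
      have "real_of_int \<bar>W\<bar> = real_of_int (p * q * x * y * \<bar>h\<bar>) / M"
        using Mpos pos unfolding W_def h by (simp add: abs_mult field_simps)
      then show ?thesis by simp
    qed
    also have "\<dots> = K * (real_of_int (p * q * x * y * \<bar>h\<bar>) powr (1 + \<eta>) / M powr (1 + \<eta>))"
      using Mpos pos by (subst powr_divide) auto
    finally have "M * real_of_int c \<le> M * (K * (real_of_int (p * q * x * y * \<bar>h\<bar>) powr (1 + \<eta>) / M powr (1 + \<eta>)))"
      using Mpos by (intro mult_left_mono) auto
    also have "\<dots> = K * real_of_int (p * q * x * y * \<bar>h\<bar>) powr (1 + \<eta>) * (M / M powr (1 + \<eta>))"
      by simp
    also have "\<dots> \<le> K * real_of_int (p * q * x * y * \<bar>h\<bar>) powr (1 + \<eta>) * 1"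
    proof (intro mult_left_mono)
      have "real_of_int M powr 1 \<le> real_of_int M powr (1 + \<eta>)"
        using Mpos \<eta> by (intro powr_mono) auto
      then show "M / M powr (1 + \<eta>) \<le> 1" using Mpos by simp
    qed (use K_def in auto)
    finally show ?thesis unfolding c by simp
  qed
  moreover have "K \<ge> 1" unfolding K_def by simp
  ultimately show ?thesis by blast
qed

lemma nth_power_pos_root:
  fixes z :: int
  assumes "is_nth_power k z" "z > 0" "k > 0"
  obtains x where "x > 0" "z = x ^ k"
  using nth_power_abs_root[OF assms(1)] assms by auto

text \<open>
  ABC for \<open>a' x\<^sup>k - a y\<^sup>k = n (a' - a)\<close>, written in logarithms. Since \<open>x\<close> and \<open>y\<close> have size
  \<open>(a b) ^ (1 / k)\<close> and \<open>(a' b) ^ (1 / k)\<close>, it reads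
  \<open>a a' b \<lless> a a'\<^sup>2 |n| (a a' b\<^sup>2) ^ (1 / k)\<close> up to \<open>\<eta>\<close>, and solving for \<open>b\<close> gives
  \<open>b ^ (k - 2) \<lless> |n|\<^sup>k a' ^ (k + 2)\<close>. The condition \<open>2 |n| \<le> a b\<close> ensures that \<open>n\<close> does
  not disturb these sizes.
\<close>

lemma abc_log_bound:
  assumes abc: "ABC_conjecture" and \<eta>: "\<eta> > 0" and k: "k > 0"
  shows "\<exists>\<kappa>\<ge>0. \<forall>(a::int) (a'::int) (b::int) (n::int). 0 < a \<longrightarrow> a < a' \<longrightarrow> 0 < b \<longrightarrow> n \<noteq> 0 \<longrightarrow> 2 * \<bar>n\<bar> \<le> a * b \<longrightarrow>
     is_nth_power k (a * b + n) \<longrightarrow> is_nth_power k (a' * b + n) \<longrightarrow>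
     (real k - 2 - 2 * \<eta>) * ln (real_of_int b)
       \<le> \<kappa> + real k * (1 + \<eta>) * ln \<bar>real_of_int n\<bar>
          + (real k + 2 + (3 * real k + 2) * \<eta>) * ln (real_of_int a')"
proof -
  obtain K where K: "K \<ge> 1" "\<And>(p::int) q x y h k. p > 0 \<Longrightarrow> q > 0 \<Longrightarrow> x > 0 \<Longrightarrow> y > 0 \<Longrightarrow> h \<noteq> 0 \<Longrightarrow>
    p * x ^ k - q * y ^ k = h \<Longrightarrow>
      real_of_int (p * x ^ k) \<le> K * real_of_int (p * q * x * y * \<bar>h\<bar>) powr (1 + \<eta>)"
    using abc_thue[OF abc \<eta>] by blast
  define \<kappa> where "\<kappa> = real k * ln K + real k * ln 2 + (1 + \<eta>) * (2 * ln 2)"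
  have "(real k - 2 - 2 * \<eta>) * ln (real_of_int b)
       \<le> \<kappa> + real k * (1 + \<eta>) * ln \<bar>real_of_int n\<bar>
          + (real k + 2 + (3 * real k + 2) * \<eta>) * ln (real_of_int a')"
    if pos: "0 < a" "a < a'" "0 < b" "n \<noteq> 0" and big: "2 * \<bar>n\<bar> \<le> a * b"
      and pw: "is_nth_power k (a * b + n)" "is_nth_power k (a' * b + n)" for a a' b n :: int
  proof -
    have a': "a' > 0" using pos by simp
    have ab': "a * b < a' * b" using pos by simp
    have "0 < a * b" using pos by simp
    then have p1: "a * b + n > 0" "a' * b + n > 0" using big ab' by linarith+
    obtain x where x: "x > 0" "a * b + n = x ^ k" using nth_power_pos_root[OF pw(1) p1(1) k] .
    obtain y where y: "y > 0" "a' * b + n = y ^ k" using nth_power_pos_root[OF pw(2) p1(2) k] .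
    define h where "h = n * (a' - a)"
    have h: "a' * x ^ k - a * y ^ k = h" "h \<noteq> 0"
      unfolding x(2)[symmetric] y(2)[symmetric] h_def using pos by (simp_all add: algebra_simps)
    define la la' lb lm lx ly where "la = ln (real_of_int a)" and "la' = ln (real_of_int a')"
      and "lb = ln (real_of_int b)" and "lm = ln \<bar>real_of_int n\<bar>"
      and "lx = ln (real_of_int x)" and "ly = ln (real_of_int y)"
    note l_defs = la_def la'_def lb_def lm_def lx_def ly_def
    have la: "0 \<le> la" "la \<le> la'" unfolding l_defs using pos by simp_all
    have "real_of_int (a' * x ^ k) \<le> K * real_of_int (a' * a * x * y * \<bar>h\<bar>) powr (1 + \<eta>)"
      by (rule K(2)) (use pos x y h a' in auto)
    also have "\<dots> \<le> K * real_of_int (a' * a * x * y * (\<bar>n\<bar> * a')) powr (1 + \<eta>)"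
    proof -
      have "\<bar>h\<bar> \<le> \<bar>n\<bar> * a'" unfolding h_def abs_mult using pos by (intro mult_left_mono) auto
      then have "a' * a * x * y * \<bar>h\<bar> \<le> a' * a * x * y * (\<bar>n\<bar> * a')"
        using pos x y a' by (intro mult_left_mono) auto
      moreover have "0 \<le> a' * a * x * y * \<bar>h\<bar>" using pos x y a' by simp
      moreover have "0 \<le> 1 + \<eta>" using \<eta> by simp
      ultimately have "real_of_int (a' * a * x * y * \<bar>h\<bar>) powr (1 + \<eta>)
             \<le> real_of_int (a' * a * x * y * (\<bar>n\<bar> * a')) powr (1 + \<eta>)"
        by (intro powr_mono2) (simp_all only: of_int_le_iff of_int_0_le_iff)
      then show ?thesis using K(1) by (intro mult_left_mono) auto
    qed
    finally have le: "real_of_int (a' * x ^ k) \<le> K * real_of_int (a' * a * x * y * (\<bar>n\<bar> * a')) powr (1 + \<eta>)" .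
    have "0 < real_of_int (a' * x ^ k)" using x a' by simp
    with le have "ln (real_of_int (a' * x ^ k)) \<le> ln (K * real_of_int (a' * a * x * y * (\<bar>n\<bar> * a')) powr (1 + \<eta>))"
      by (subst ln_le_cancel_iff) linarith+
    also have "\<dots> = ln K + (1 + \<eta>) * (la' + la + lx + ly + (lm + la'))"
      using K(1) pos x y a' by (simp add: l_defs ln_mult ln_powr)
    also have "ln (real_of_int (a' * x ^ k)) = la' + ln (real_of_int (x ^ k))"
      using pos x a' by (simp add: l_defs ln_mult)
    finally have main: "la' + ln (real_of_int (x ^ k)) \<le> ln K + (1 + \<eta>) * (2 * la' + la + lx + ly + lm)"
      by (simp add: algebra_simps)
    have up: "real k * ln (real_of_int u) \<le> ln 2 + ln (real_of_int c) + lb"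
      if "u > 0" "0 < c" "u ^ k \<le> 2 * (c * b)" for u c :: int
    proof -
      have "real k * ln (real_of_int u) = ln (real_of_int (u ^ k))"
        using that by (simp add: ln_realpow)
      also have "\<dots> \<le> ln (real_of_int (2 * (c * b)))"
        using that pos by (intro ln_of_int_mono) auto
      also have "\<dots> = ln 2 + ln (real_of_int c) + lb" using that pos by (simp add: l_defs ln_mult)
      finally show ?thesis .
    qed
    have "x ^ k \<le> 2 * (a * b)" "y ^ k \<le> 2 * (a' * b)"
      unfolding x(2)[symmetric] y(2)[symmetric] using big ab' by linarith+
    with up[OF x(1) pos(1)] up[OF y(1) a'] have lxy: "real k * (lx + ly) \<le> 2 * ln 2 + la + la' + 2 * lb"
      unfolding l_defs by (simp add: algebra_simps)
    have "- (a * b) \<le> 2 * n" using big by linarith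
    then have "a * b \<le> 2 * x ^ k" unfolding x(2)[symmetric] by (simp add: algebra_simps)
    then have "ln (real_of_int (a * b)) \<le> ln (real_of_int (2 * x ^ k))"
      using pos x by (intro ln_of_int_mono) auto
    then have lx: "la + lb \<le> ln 2 + ln (real_of_int (x ^ k))"
      using pos x by (simp add: l_defs ln_mult)
    have "real k * (la' + la + lb - ln 2) \<le> real k * (ln K + (1 + \<eta>) * (2 * la' + la + lx + ly + lm))"
      using main lx by (intro mult_left_mono) auto
    also have "\<dots> = real k * ln K + (1 + \<eta>) * (real k * (2 * la' + la + lm)) + (1 + \<eta>) * (real k * (lx + ly))"
      by (simp add: algebra_simps)
    also have "\<dots> \<le> real k * ln K + (1 + \<eta>) * (real k * (2 * la' + la + lm)) + (1 + \<eta>) * (2 * ln 2 + la + la' + 2 * lb)"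
      using lxy \<eta> by (intro add_left_mono mult_left_mono) auto
    finally have 1: "real k * (la' + la + lb - ln 2) \<le> \<dots>" .
    have "(real k * \<eta> + 1 + \<eta>) * la \<le> (real k * \<eta> + 1 + \<eta>) * la'"
      using la \<eta> by (intro mult_left_mono) auto
    then show ?thesis using 1 unfolding \<kappa>_def la'_def[symmetric] lb_def[symmetric] lm_def[symmetric]
      by (simp add: algebra_simps)
  qed
  moreover have "\<kappa> \<ge> 0" unfolding \<kappa>_def using K(1) \<eta> by simp
  ultimately show ?thesis by blast
qed

lemma power_diff_abs_ge:
  fixes u v :: int
  assumes "u \<ge> 0" "v > 0" "u \<noteq> v" "k > 0"
  shows "v ^ (k - 1) \<le> \<bar>u ^ k - v ^ k\<bar>"
proof (cases "v < u")
  case True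
  have "v ^ (k - 1) * 1 \<le> (int k * v ^ (k - 1)) * (u - v)"
    using True assms by (intro mult_mono) auto
  also have "\<dots> \<le> u ^ k - v ^ k" using power_diff_ge[of v u k] True assms by simp
  finally show ?thesis by simp
next
  case False
  have "u ^ k \<le> u * v ^ (k - 1)"
    using assms False by (metis Suc_diff_1 linorder_not_less mult_left_mono power_Suc power_mono)
  also have "\<dots> \<le> (v - 1) * v ^ (k - 1)" using False assms by (intro mult_right_mono) auto
  also have "\<dots> = v ^ k - v ^ (k - 1)" using assms by (metis Suc_diff_1 left_diff_distrib mult_1 power_Suc)
  finally show ?thesis by simp
qed

text \<open>
  The numbers \<open>(a b' + n) (a' b + n)\<close> and \<open>(a b + n) (a' b' + n)\<close> are distinct \<open>k\<close>-th powers whose difference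
  is only \<open>n (a' - a) (b' - b)\<close>. As distinct \<open>k\<close>-th powers near \<open>Q\<^sup>k\<close> differ by at least \<open>Q ^ (k - 1)\<close>, this
  yields \<open>(a b) ^ (k - 1) \<lless> |n|\<^sup>k a' b'\<close>.
\<close>

lemma gap_log_bound:
  fixes a a' b b' n :: int
  assumes k: "k > 0" and pos: "0 < a" "a < a'" "0 < b" "b < b'" "n \<noteq> 0" and big: "2 * \<bar>n\<bar> \<le> a * b"
    and pw: "is_nth_power k (a * b + n)" "is_nth_power k (a' * b + n)"
            "is_nth_power k (a * b' + n)" "is_nth_power k (a' * b' + n)"
  shows "(real k - 1) * (ln (real_of_int a) + ln (real_of_int b))
           \<le> ln (real_of_int a') + ln (real_of_int b') + real k * ln \<bar>real_of_int n\<bar> + 2 * real k"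
proof -
  have ord: "a * b < a' * b" "a * b < a * b'" "a * b < a' * b'"
    using pos by (auto intro: mult_strict_mono)
  have ge: "a * b \<le> 2 * (a * b + n)" "a' * b' \<le> 2 * (a' * b' + n)" 
  proof -
    have "- (a * b) \<le> 2 * n" using big by linarith
    then show "a * b \<le> 2 * (a * b + n)" "a' * b' \<le> 2 * (a' * b' + n)"
      using ord by (simp_all add: algebra_simps)
  qed
  have p: "0 < a * b + n" "0 < a' * b + n" "0 < a * b' + n" "0 < a' * b' + n"
  proof -
    have "- (a * b) < n" using big mult_pos_pos[OF pos(1,3)] by linarith
    then show "0 < a * b + n" "0 < a' * b + n" "0 < a * b' + n" "0 < a' * b' + n"
      using ord by linarith+
  qed
  obtain x where x: "x > 0" "a * b + n = x ^ k" using nth_power_pos_root[OF pw(1) p(1) k] .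
  obtain y where y: "y > 0" "a' * b + n = y ^ k" using nth_power_pos_root[OF pw(2) p(2) k] .
  obtain x' where x': "x' > 0" "a * b' + n = x' ^ k" using nth_power_pos_root[OF pw(3) p(3) k] .
  obtain y' where y': "y' > 0" "a' * b' + n = y' ^ k" using nth_power_pos_root[OF pw(4) p(4) k] .
  define Q where "Q = x * y'"
  define P where "P = x' * y"
  have Q: "Q ^ k = (a * b + n) * (a' * b' + n)" and P: "P ^ k = (a * b' + n) * (a' * b + n)"
    unfolding P_def Q_def power_mult_distrib x y x' y' by simp_all
  have PQ: "P ^ k - Q ^ k = - (n * ((a' - a) * (b' - b)))"
    unfolding P Q by (simp add: algebra_simps)
  then have ne: "P \<noteq> Q" using pos by auto
  have "Q ^ (k - 1) \<le> \<bar>P ^ k - Q ^ k\<bar>"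
    using ne k x y x' y' by (intro power_diff_abs_ge) (auto simp: P_def Q_def)
  also have "\<dots> = \<bar>n\<bar> * ((a' - a) * (b' - b))" unfolding PQ using pos by (simp add: abs_mult)
  also have "\<dots> \<le> \<bar>n\<bar> * (a' * b')" using pos by (intro mult_left_mono mult_mono) auto
  finally have le: "Q ^ (k - 1) \<le> \<bar>n\<bar> * (a' * b')" .
  have Qpos: "Q > 0" unfolding Q_def using x y' by simp
  define lS lS' lm lQ where "lS = ln (real_of_int a) + ln (real_of_int b)"
    and "lS' = ln (real_of_int a') + ln (real_of_int b')"
    and "lm = ln \<bar>real_of_int n\<bar>" and "lQ = ln (real_of_int Q)"
  note l_defs = lS_def lS'_def lm_def lQ_def
  have k1: "real (k - 1) = real k - 1" using k by simp
  have "ln (real_of_int (Q ^ (k - 1))) \<le> ln (real_of_int (\<bar>n\<bar> * (a' * b')))"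
    using le Qpos pos by (intro ln_of_int_mono) auto
  then have 1: "(real k - 1) * lQ \<le> lm + lS'"
    using Qpos pos k1 by (simp add: l_defs ln_realpow ln_mult)
  have "(a * b) * (a' * b') \<le> (2 * (a * b + n)) * (2 * (a' * b' + n))"
    by (rule mult_mono[OF ge]) (use p pos in auto)
  also have "\<dots> = 4 * Q ^ k" unfolding Q by (simp add: algebra_simps)
  finally have "(a * b) * (a' * b') \<le> 4 * Q ^ k" .
  then have "ln (real_of_int ((a * b) * (a' * b'))) \<le> ln (real_of_int (4 * Q ^ k))"
    using Qpos pos by (intro ln_of_int_mono) auto
  then have 2: "lS + lS' \<le> ln 4 + real k * lQ"
    using Qpos pos by (simp add: l_defs ln_realpow ln_mult)
  have "ln (4::real) \<le> 2"
  proof -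
    have "ln (4::real) = 2 * ln 2" using ln_realpow[of 2 2] by simp
    then show ?thesis using ln_2_less_1 by simp
  qed
  have "(real k - 1) * (lS + lS') \<le> (real k - 1) * (2 + real k * lQ)"
    using 2 \<open>ln 4 \<le> 2\<close> k by (intro mult_left_mono) auto
  also have "\<dots> = 2 * (real k - 1) + real k * ((real k - 1) * lQ)" by (simp add: algebra_simps)
  also have "\<dots> \<le> 2 * (real k - 1) + real k * (lm + lS')"
    using 1 by (intro add_left_mono mult_left_mono) auto
  finally have "(real k - 1) * lS \<le> lS' + real k * lm + 2 * real k" by (simp add: algebra_simps)
  then show ?thesis unfolding l_defs by simp
qed

section \<open>Tuples with a large second element\<close>

text \<open>
  Pairs of an exponent \<open>k\<close> and a number \<open>r\<close> of elements of \<open>A\<close> for which the geometric growth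
  in \<open>A\<close> contradicts the ABC bound. For \<open>r = 2\<close> this amounts to \<open>(k - 2)\<^sup>2 > k + 2\<close>, that is
  \<open>k \<ge> 5\<close>.
\<close>

definition admissible :: "nat \<Rightarrow> nat \<Rightarrow> bool" where
  "admissible k r \<longleftrightarrow> k \<ge> 5 \<and> r = 2 \<or> k = 4 \<and> r = 3 \<or> k = 3 \<and> r = 4"

text \<open>
  This serves both as the \<open>\<epsilon>\<close> in the ABC conjecture and as the closeness of the logarithms of two
  elements of \<open>B\<close>, measured in units of \<open>ln (a 1)\<close>. It is quadratic in \<open>1 / k\<close> because
  \<open>log_chain_bound\<close> multiplies it by quantities of size \<open>k\<^sup>2\<close>.
\<close>

definition slack :: "nat \<Rightarrow> real" where
  "slack k = 1 / (100 * (real k)\<^sup>2)"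

lemma slack_bounds:
  assumes "k \<ge> 3"
  shows "0 < slack k" "slack k \<le> 1 / 900"
proof -
  show "0 < slack k" unfolding slack_def using assms by simp
  have "3\<^sup>2 \<le> (real k)\<^sup>2" using assms by (intro power_mono) auto
  then show "slack k \<le> 1 / 900" unfolding slack_def using assms by (simp add: field_simps)
qed

text \<open>
  Here \<open>l i\<close> are the logarithms of the elements of \<open>A\<close>, \<open>\<beta>\<close> and \<open>\<beta>'\<close> those of two close elements of
  \<open>B\<close>, and \<open>\<mu>\<close> that of \<open>|n|\<close>. Neglecting \<open>\<mu>\<close> and the slack, the gaps say
  \<open>l (i + 1) \<ge> (k - 1) l i + (k - 2) \<beta>\<close> and ABC says \<open>(k - 2) l (r - 1) \<le> (k + 2) \<beta>\<close>. The first
  gap gives \<open>(k - 2) \<beta> \<le> l 1\<close>, and the other gaps increase the lower bound for the last logarithm: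

  \<^item> \<open>r = 2\<close>: \<open>(k - 2)\<^sup>2 l 1 \<le> (k + 2) (k - 2) \<beta> \<le> (k + 2) l 1\<close>;
  \<^item> \<open>k = 4\<close>: \<open>2 (3 l 1 + 2 \<beta>) \<le> 6 \<beta>\<close>, so \<open>6 l 1 \<le> 2 \<beta> \<le> l 1\<close>;
  \<^item> \<open>k = 3\<close>: \<open>4 l 1 + 3 \<beta> \<le> 5 \<beta>\<close>, so \<open>4 l 1 \<le> 2 \<beta> \<le> 2 l 1\<close>.

  Each is impossible for positive \<open>l 1\<close>; so \<open>l 1\<close> is bounded by the neglected terms.
\<close>

lemma log_chain_bound:
  fixes \<kappa> :: real
  assumes adm: "admissible k r" and \<kappa>: "\<kappa> \<ge> 0"
  shows "\<exists>T\<ge>0. \<forall>(l::nat \<Rightarrow> real) \<beta> \<beta>' \<mu>. 0 \<le> l 0 \<longrightarrow> 0 \<le> \<mu> \<longrightarrow> \<beta>' \<le> \<beta> + slack k * l 1 \<longrightarrow>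
     (\<forall>i. Suc i < r \<longrightarrow> (real k - 1) * (l i + \<beta>) \<le> l (Suc i) + \<beta>' + real k * \<mu> + 2 * real k) \<longrightarrow>
     (real k - 2 - 2 * slack k) * l (r - 1)
        \<le> \<kappa> + real k * (1 + slack k) * \<mu> + (real k + 2 + (3 * real k + 2) * slack k) * \<beta>' \<longrightarrow>
     l 1 \<le> T * (1 + \<mu>)"
proof -
  consider "k \<ge> 5" "r = 2" | "k = 4" "r = 3" | "k = 3" "r = 4"
    using adm unfolding admissible_def by blast
  then show ?thesis
  proof cases
    case 1
    define x e where "x = real k" and "e = slack k"
    have x: "x \<ge> 5" unfolding x_def using 1 by simp
    have e: "e > 0" "e \<le> 1 / 900" unfolding e_def using slack_bounds 1 by auto
    have xxe: "x * (x * e) = 1 / 100"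
      unfolding e_def slack_def x_def using 1 by (simp add: power2_eq_square)
    have xe: "0 \<le> x * e" "x * e \<le> 1 / 500"
    proof -
      show "0 \<le> x * e" using x e by simp
      then have "5 * (x * e) \<le> x * (x * e)" using x by (intro mult_right_mono)
      then show "x * e \<le> 1 / 500" unfolding xxe by simp
    qed
    define E where "E = x + 2 + (3 * x + 2) * e"
    have E: "E \<ge> 0" unfolding E_def using x e by simp
    \<comment> \<open>the perturbed form of \<open>(k - 2)\<^sup>2 - (k + 2) = k (k - 5) + 2\<close>\<close>
    define D where "D = (x - 2) * (x - 2 - 2 * e) - E * (1 + (x - 1) * e)"
    have "D = x * (x - 5) + 2 - 6 * (x * e) + 4 * e - x * (x * e) - 3 * (x * (x * e)) * e + x * e * e + 2 * (e * e)"
      unfolding D_def E_def by (simp add: algebra_simps)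
    moreover have "x * (x - 5) \<ge> 0" "x * e * e \<ge> 0" "e * e \<ge> 0" using x e by simp_all
    ultimately have D: "D \<ge> 1" using xe e unfolding xxe by linarith
    define c1 c2 where "c1 = (x - 2) * \<kappa> + 2 * x * E" and "c2 = (x - 2) * (x * (1 + e)) + x * E"
    have c: "c1 \<ge> 0" "c2 \<ge> 0" unfolding c1_def c2_def using x e E \<kappa> by simp_all
    have "l 1 \<le> (c1 + c2) * (1 + \<mu>)"
      if l: "0 \<le> l 0" "0 \<le> \<mu>" "\<beta>' \<le> \<beta> + e * l 1"
        and gap: "(x - 1) * (l 0 + \<beta>) \<le> l 1 + \<beta>' + x * \<mu> + 2 * x"
        and abc: "(x - 2 - 2 * e) * l 1 \<le> \<kappa> + x * (1 + e) * \<mu> + E * \<beta>'"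
      for l :: "nat \<Rightarrow> real" and \<beta> \<beta>' \<mu>
    proof -
      have "(x - 1) * \<beta> \<le> (x - 1) * (l 0 + \<beta>)" using l x by (intro mult_left_mono) auto
      then have up: "(x - 2) * \<beta> \<le> (1 + e) * l 1 + x * \<mu> + 2 * x"
        using gap l(3) by (simp add: algebra_simps)
      have "(x - 2) * ((x - 2 - 2 * e) * l 1) \<le> (x - 2) * (\<kappa> + x * (1 + e) * \<mu> + E * (\<beta> + e * l 1))"
        using abc x mult_left_mono[OF l(3) E] by (intro mult_left_mono) linarith+
      also have "\<dots> = (x - 2) * (\<kappa> + x * (1 + e) * \<mu>) + E * ((x - 2) * \<beta>) + E * ((x - 2) * e * l 1)"
        by (simp add: algebra_simps)
      also have "\<dots> \<le> (x - 2) * (\<kappa> + x * (1 + e) * \<mu>) + E * ((1 + e) * l 1 + x * \<mu> + 2 * x) + E * ((x - 2) * e * l 1)"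
        using mult_left_mono[OF up E] by simp
      finally have "D * l 1 \<le> c1 + c2 * \<mu>"
        unfolding D_def c1_def c2_def by (simp add: algebra_simps)
      also have "\<dots> \<le> (c1 + c2) * (1 + \<mu>)" using c l by (simp add: algebra_simps)
      finally have "D * l 1 \<le> (c1 + c2) * (1 + \<mu>)" .
      moreover have "l 1 \<le> D * l 1 \<or> l 1 \<le> 0" using D mult_right_mono[of 1 D "l 1"] by linarith
      moreover have "0 \<le> (c1 + c2) * (1 + \<mu>)" using c l by simp
      ultimately show ?thesis by linarith
    qed
    then show ?thesis
      using c 1 unfolding x_def e_def E_def by (intro exI[of _ "c1 + c2"]) auto
  next
    case 2
    have e: "slack k = 1 / 1600" unfolding slack_def 2 by simp
    have "l 1 \<le> (\<kappa> + 40) * (1 + \<mu>)"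
      if l: "0 \<le> l 0" "0 \<le> \<mu>" "\<beta>' \<le> \<beta> + slack k * l 1"
        and gap: "\<forall>i. Suc i < r \<longrightarrow> (real k - 1) * (l i + \<beta>) \<le> l (Suc i) + \<beta>' + real k * \<mu> + 2 * real k"
        and abc: "(real k - 2 - 2 * slack k) * l (r - 1)
        \<le> \<kappa> + real k * (1 + slack k) * \<mu> + (real k + 2 + (3 * real k + 2) * slack k) * \<beta>'"
      for l :: "nat \<Rightarrow> real" and \<beta> \<beta>' \<mu>
    proof -
      have g: "3 * (l 0 + \<beta>) \<le> l 1 + \<beta>' + 4 * \<mu> + 8" "3 * (l 1 + \<beta>) \<le> l 2 + \<beta>' + 4 * \<mu> + 8"
        using gap[rule_format, of 0] gap[rule_format, of 1] 2 by (simp_all add: eval_nat_numeral)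
      have "(2 - 2 / 1600) * l 2 \<le> \<kappa> + 4 * (1 + 1 / 1600) * \<mu> + (6 + 14 / 1600) * \<beta>'"
        using abc[unfolded e] 2 by simp
      then have "l 1 \<le> \<kappa> + 40 * \<mu> + 40" using g l \<kappa> unfolding e by (simp add: field_simps)
      also have "\<dots> \<le> (\<kappa> + 40) * (1 + \<mu>)" using l \<kappa> by (simp add: algebra_simps)
      finally show ?thesis .
    qed
    then show ?thesis using \<kappa> by (intro exI[of _ "\<kappa> + 40"]) auto
  next
    case 3
    have e: "slack k = 1 / 900" unfolding slack_def 3 by simp
    have "l 1 \<le> (\<kappa> + 40) * (1 + \<mu>)"
      if l: "0 \<le> l 0" "0 \<le> \<mu>" "\<beta>' \<le> \<beta> + slack k * l 1"
        and gap: "\<forall>i. Suc i < r \<longrightarrow> (real k - 1) * (l i + \<beta>) \<le> l (Suc i) + \<beta>' + real k * \<mu> + 2 * real k"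
        and abc: "(real k - 2 - 2 * slack k) * l (r - 1)
        \<le> \<kappa> + real k * (1 + slack k) * \<mu> + (real k + 2 + (3 * real k + 2) * slack k) * \<beta>'"
      for l :: "nat \<Rightarrow> real" and \<beta> \<beta>' \<mu>
    proof -
      have g: "2 * (l 0 + \<beta>) \<le> l 1 + \<beta>' + 3 * \<mu> + 6" "2 * (l 1 + \<beta>) \<le> l 2 + \<beta>' + 3 * \<mu> + 6"
         "2 * (l 2 + \<beta>) \<le> l 3 + \<beta>' + 3 * \<mu> + 6"
        using gap[rule_format, of 0] gap[rule_format, of 1] gap[rule_format, of 2] 3
        by (simp_all add: eval_nat_numeral)
      have "(1 - 2 / 900) * l 3 \<le> \<kappa> + 3 * (1 + 1 / 900) * \<mu> + (5 + 11 / 900) * \<beta>'"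
        using abc[unfolded e] 3 by simp
      then have "l 1 \<le> \<kappa> + 40 * \<mu> + 40" using g l \<kappa> unfolding e by (simp add: field_simps)
      also have "\<dots> \<le> (\<kappa> + 40) * (1 + \<mu>)" using l \<kappa> by (simp add: algebra_simps)
      finally show ?thesis .
    qed
    then show ?thesis using \<kappa> by (intro exI[of _ "\<kappa> + 40"]) auto
  qed
qed

text \<open>
  When \<open>a b < 2 |n|\<close>, the logarithmic ABC bound is not available, but then \<open>b\<close> is small anyway.
\<close>

lemma abc_log_bound_uniform:
  assumes abc: "ABC_conjecture" and k: "k \<ge> 3"
  shows "\<exists>U\<ge>0. \<forall>(a::int) a' b n. 0 < a \<longrightarrow> a < a' \<longrightarrow> 0 < b \<longrightarrow> n \<noteq> 0 \<longrightarrow>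
     is_nth_power k (a * b + n) \<longrightarrow> is_nth_power k (a' * b + n) \<longrightarrow>
     ln (real_of_int b) \<le> U * (1 + ln \<bar>real_of_int n\<bar> + ln (real_of_int a'))"
proof -
  define e where "e = slack k"
  have e: "e > 0" "e \<le> 1 / 900" unfolding e_def using slack_bounds k by auto
  obtain \<kappa> where \<kappa>: "\<kappa> \<ge> 0" "\<And>(a::int) a' b n. 0 < a \<Longrightarrow> a < a' \<Longrightarrow> 0 < b \<Longrightarrow> n \<noteq> 0 \<Longrightarrow> 2 * \<bar>n\<bar> \<le> a * b \<Longrightarrow>
     is_nth_power k (a * b + n) \<Longrightarrow> is_nth_power k (a' * b + n) \<Longrightarrow>
     (real k - 2 - 2 * e) * ln (real_of_int b) \<le> \<kappa> + real k * (1 + e) * ln \<bar>real_of_int n\<bar>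
          + (real k + 2 + (3 * real k + 2) * e) * ln (real_of_int a')"
    using abc_log_bound[OF abc e(1), of k] k by auto
  define g where "g = real k - 2 - 2 * e"
  define F where "F = \<kappa> + real k * (1 + e) + (real k + 2 + (3 * real k + 2) * e)"
  have g: "g > 0" unfolding g_def using k e by simp
  have F: "F \<ge> 0" unfolding F_def using k e \<kappa> by simp
  have "ln (real_of_int b) \<le> (F / g + 1) * (1 + ln \<bar>real_of_int n\<bar> + ln (real_of_int a'))"
    if pos: "0 < a" "a < a'" "0 < b" "n \<noteq> 0" and pw: "is_nth_power k (a * b + n)" "is_nth_power k (a' * b + n)"
    for a a' b n :: int
  proof -
    define \<mu> l where "\<mu> = ln \<bar>real_of_int n\<bar>" and "l = ln (real_of_int a')"
    have n: "\<bar>real_of_int n\<bar> \<ge> 1" using pos(4) by linarith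
    then have \<mu>: "\<mu> \<ge> 0" unfolding \<mu>_def by simp
    have l: "l \<ge> 0" unfolding l_def using pos by simp
    have sum: "0 \<le> F / g * (1 + \<mu> + l)" using F g \<mu> l by simp
    show ?thesis
    proof (cases "2 * \<bar>n\<bar> \<le> a * b")
      case True
      have "g * ln (real_of_int b) \<le> \<kappa> + real k * (1 + e) * \<mu> + (real k + 2 + (3 * real k + 2) * e) * l"
        unfolding g_def \<mu>_def l_def by (rule \<kappa>(2)[OF pos True pw])
      also have "\<dots> \<le> F * (1 + \<mu> + l)"
      proof -
        define p q where "p = real k * (1 + e)" and "q = real k + 2 + (3 * real k + 2) * e"
        have "p \<ge> 0" "q \<ge> 0" unfolding p_def q_def using e by simp_all
        then have "\<kappa> + p * \<mu> + q * l \<le> (\<kappa> + p + q) * (1 + \<mu> + l)"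
          using \<kappa>(1) \<mu> l by (simp add: algebra_simps)
        then show ?thesis unfolding F_def p_def q_def .
      qed
      finally have "ln (real_of_int b) \<le> F / g * (1 + \<mu> + l)" using g by (simp add: field_simps)
      then show ?thesis unfolding \<mu>_def[symmetric] l_def[symmetric] using \<mu> l by (simp add: distrib_right)
    next
      case False
      have "b \<le> a * b" using pos by simp
      then have "b \<le> 2 * \<bar>n\<bar>" using False by linarith
      then have "ln (real_of_int b) \<le> ln (real_of_int (2 * \<bar>n\<bar>))" using pos by (intro ln_of_int_mono)
      also have "\<dots> = ln 2 + \<mu>" unfolding \<mu>_def using pos by (simp add: ln_mult)
      also have "\<dots> \<le> 1 + \<mu> + l" using ln_2_less_1 l by linarith
      finally show ?thesis unfolding \<mu>_def[symmetric] l_def[symmetric] using sum by (simp add: distrib_right)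
    qed
  qed
  moreover have "F / g + 1 \<ge> 0" using F g by simp
  ultimately show ?thesis by (intro exI[of _ "F / g + 1"]) simp
qed

lemma chain_mono:
  fixes a :: "nat \<Rightarrow> int"
  assumes "\<And>i. Suc i < r \<Longrightarrow> a i < a (Suc i)" "i \<le> j" "j < r"
  shows "a i \<le> a j"
  using assms(2,3)
proof (induction j rule: dec_induct)
  case (step j)
  then show ?case using assms(1)[of j] by simp
qed simp

text \<open>
  Let \<open>L = ln (a 1)\<close>. ABC confines the logarithms of \<open>B\<close>, apart from its least element, to a bounded
  multiple of \<open>L\<close>, and \<open>log_chain_bound\<close> shows that any two of them differ by more than a fixed
  fraction of \<open>L\<close>. The lower end of the range comes from ABC with \<open>A\<close> and \<open>B\<close> exchanged: since \<open>b0 * a 1 + n\<close>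
  and \<open>b * a 1 + n\<close> are both \<open>k\<close>-th powers, where \<open>b0\<close> is the least element of \<open>B\<close>, the number \<open>a 1\<close> is at most a
  power of \<open>|n| b\<close>. As \<open>a 1\<close> is huge compared with \<open>|n|\<close>, this gives the conditions \<open>2 |n| \<le> a i * b\<close>.
\<close>

lemma card_le_of_large_second_element:
  assumes abc: "ABC_conjecture" and adm: "admissible k r"
  shows "\<exists>T\<ge>1. \<exists>J::nat. \<forall>(a::nat \<Rightarrow> int) n B. n \<noteq> 0 \<longrightarrow> 0 < a 0 \<longrightarrow> (\<forall>i. Suc i < r \<longrightarrow> a i < a (Suc i)) \<longrightarrow>
     B \<noteq> {} \<longrightarrow> (\<forall>b\<in>B. b > 0 \<and> (\<forall>i<r. is_nth_power k (a i * b + n))) \<longrightarrow>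
     T * (1 + ln \<bar>real_of_int n\<bar>) < ln (real_of_int (a 1)) \<longrightarrow> finite B \<and> card B \<le> J"
proof -
  have k: "k \<ge> 3" and r: "r \<ge> 2" using adm unfolding admissible_def by auto
  define e where "e = slack k"
  have e: "e > 0" "e \<le> 1 / 900" unfolding e_def using slack_bounds k by auto
  define E where "E = real k + 2 + (3 * real k + 2) * e"
  obtain \<kappa> where \<kappa>: "\<kappa> \<ge> 0" "\<And>(a::int) a' b n. 0 < a \<Longrightarrow> a < a' \<Longrightarrow> 0 < b \<Longrightarrow> n \<noteq> 0 \<Longrightarrow> 2 * \<bar>n\<bar> \<le> a * b \<Longrightarrow>
     is_nth_power k (a * b + n) \<Longrightarrow> is_nth_power k (a' * b + n) \<Longrightarrow>
     (real k - 2 - 2 * e) * ln (real_of_int b) \<le> \<kappa> + real k * (1 + e) * ln \<bar>real_of_int n\<bar>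
          + E * ln (real_of_int a')"
    using abc_log_bound[OF abc e(1), of k] k unfolding E_def by auto
  obtain U where U: "U \<ge> 0" "\<And>(a::int) a' b n. 0 < a \<Longrightarrow> a < a' \<Longrightarrow> 0 < b \<Longrightarrow> n \<noteq> 0 \<Longrightarrow>
     is_nth_power k (a * b + n) \<Longrightarrow> is_nth_power k (a' * b + n) \<Longrightarrow>
     ln (real_of_int b) \<le> U * (1 + ln \<bar>real_of_int n\<bar> + ln (real_of_int a'))"
    using abc_log_bound_uniform[OF abc k] by auto
  obtain T0 where T0: "T0 \<ge> 0" "\<And>(l::nat \<Rightarrow> real) \<beta> \<beta>' \<mu>. 0 \<le> l 0 \<Longrightarrow> 0 \<le> \<mu> \<Longrightarrow> \<beta>' \<le> \<beta> + e * l 1 \<Longrightarrow>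
     (\<forall>i. Suc i < r \<longrightarrow> (real k - 1) * (l i + \<beta>) \<le> l (Suc i) + \<beta>' + real k * \<mu> + 2 * real k) \<Longrightarrow>
     (real k - 2 - 2 * e) * l (r - 1) \<le> \<kappa> + real k * (1 + e) * \<mu> + E * \<beta>' \<Longrightarrow> l 1 \<le> T0 * (1 + \<mu>)"
    using log_chain_bound[OF adm \<kappa>(1)] unfolding e_def E_def by blast
  define g where "g = real k - 2 - 2 * e"
  define F where "F = \<kappa> + real k * (1 + e)"
  have g: "g > 0" unfolding g_def using k e by simp
  have F: "F \<ge> 0" unfolding F_def using k e \<kappa> by simp
  have E: "E > 0" unfolding E_def using k e by (simp add: add_pos_nonneg)
  \<comment> \<open>The summands ensure in turn: \<open>a 1 \<ge> 2 |n|\<close>; the contradiction for close pairs; that the terms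
    with \<open>n\<close> take at most half of the lower bound for \<open>B\<close>; and that this lower bound exceeds \<open>2 |n|\<close>.\<close>
  define T where "T = 1 + T0 + 2 * F / g + 2 * E / g"
  have T: "T \<ge> 1" "T \<ge> T0" "T \<ge> 2 * F / g" "T \<ge> 2 * E / g"
    unfolding T_def using T0(1) F g E by simp_all
  define J where "J = nat \<lfloor>2 * U / e\<rfloor> + 2"
  have "finite B \<and> card B \<le> J"
    if n: "n \<noteq> 0" and a: "0 < a 0" "\<forall>i. Suc i < r \<longrightarrow> a i < a (Suc i)" and B: "B \<noteq> {}"
      "\<forall>b\<in>B. b > 0 \<and> (\<forall>i<r. is_nth_power k (a i * b + n))"
      and big: "T * (1 + ln \<bar>real_of_int n\<bar>) < ln (real_of_int (a 1))"
    for a :: "nat \<Rightarrow> int" and n B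
  proof -
    define \<mu> L where "\<mu> = ln \<bar>real_of_int n\<bar>" and "L = ln (real_of_int (a 1))"
    have "\<bar>real_of_int n\<bar> \<ge> 1" using n by linarith
    then have \<mu>: "\<mu> \<ge> 0" unfolding \<mu>_def by simp
    have TL: "c * (1 + \<mu>) < L" if "c \<le> T" for c
    proof -
      have "c * (1 + \<mu>) \<le> T * (1 + \<mu>)" using that \<mu> by (intro mult_right_mono) auto
      then show ?thesis using big unfolding \<mu>_def L_def by linarith
    qed
    have L: "L > 1 + \<mu>" using TL[OF T(1)] by simp
    then have L0: "L > 0" using \<mu> by simp
    have chain: "a 0 \<le> a i" if "i < r" for i
      using chain_mono[of r a 0 i] a(2) that by simp
    have a01: "a 0 < a 1" using a(2) r by simp
    then have a1: "a 1 > 0" using a(1) by simp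
    have ln2n: "2 * \<bar>n\<bar> \<le> u" if "u > 0" "1 + \<mu> \<le> ln (real_of_int u)" for u :: int
    proof (rule ccontr)
      assume "\<not> 2 * \<bar>n\<bar> \<le> u"
      then have "ln (real_of_int u) \<le> ln (real_of_int (2 * \<bar>n\<bar>))" using that by (intro ln_of_int_mono) auto
      also have "\<dots> = ln 2 + \<mu>" unfolding \<mu>_def using n by (simp add: ln_mult)
      finally show False using that ln_2_less_1 by linarith
    qed
    obtain b0 where b0: "b0 \<in> B" "\<And>b. b \<in> B \<Longrightarrow> b0 \<le> b"
    proof -
      obtain b1 where "b1 \<in> B" using B by auto
      then obtain b0 where "b0 \<in> B" "\<forall>b. b \<in> B \<longrightarrow> nat b0 \<le> nat b"
        using ex_has_least_nat[of "\<lambda>b. b \<in> B" b1 nat] by auto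
      then show ?thesis using that[of b0] B(2) by (meson leD leI nat_mono_iff)
    qed
    have Bpos: "b > 0" and Bpw: "i < r \<Longrightarrow> is_nth_power k (a i * b + n)" if "b \<in> B" for b i
      using B(2) that by auto
    have a1_big: "2 * \<bar>n\<bar> \<le> a 1" using ln2n[of "a 1"] a a01 L unfolding L_def by simp
    have low: "2 * \<bar>n\<bar> \<le> b" if b: "b \<in> B" "b \<noteq> b0" for b
    proof -
      have lt: "b0 < b" using b0 b by (simp add: order.strict_iff_order)
      have "a 1 \<le> b0 * a 1" using Bpos[OF b0(1)] a a01 by simp
      then have "2 * \<bar>n\<bar> \<le> b0 * a 1" using a1_big by linarith
      then have "g * L \<le> \<kappa> + real k * (1 + e) * \<mu> + E * ln (real_of_int b)"
        unfolding g_def L_def \<mu>_def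
        using \<kappa>(2)[of b0 b "a 1" n] Bpos[OF b0(1)] lt a1 n Bpw[OF b0(1), of 1] Bpw[OF b(1), of 1] r
        by (simp add: mult.commute)
      also have "\<kappa> + real k * (1 + e) * \<mu> \<le> F * (1 + \<mu>)"
        unfolding F_def using \<kappa>(1) \<mu> e by (simp add: algebra_simps)
      also have "F * (1 + \<mu>) \<le> g * L / 2"
        using TL[OF T(3)] g by (simp add: field_simps)
      finally have "g * L / 2 \<le> E * ln (real_of_int b)" by simp
      moreover have "E * (1 + \<mu>) \<le> g * L / 2" using TL[OF T(4)] g by (simp add: field_simps)
      ultimately have "E * (1 + \<mu>) \<le> E * ln (real_of_int b)" by linarith
      then have "1 + \<mu> \<le> ln (real_of_int b)" using E by simp
      then show ?thesis using ln2n Bpos[OF b(1)] by blast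
    qed
    have up: "ln (real_of_int b) \<le> 2 * U * L" if "b \<in> B" for b
    proof -
      have "ln (real_of_int b) \<le> U * (1 + \<mu> + L)"
        unfolding \<mu>_def L_def using that a a01 n Bpos Bpw[of b 0] Bpw[of b 1] r by (intro U(2)[of "a 0"]) auto
      also have "\<dots> \<le> U * (L + L)" using U(1) L by (intro mult_left_mono) auto
      finally show ?thesis by simp
    qed
    have sep: "ln (real_of_int b) + e * L < ln (real_of_int b')"
      if b: "b \<in> B - {b0}" "b' \<in> B" "b < b'" for b b'
    proof (rule ccontr)
      assume "\<not> ?thesis"
      then have close: "ln (real_of_int b') \<le> ln (real_of_int b) + e * L" by simp
      have bb: "b > 0" "b' > 0" "2 * \<bar>n\<bar> \<le> b" using b Bpos low by auto
      have ab: "2 * \<bar>n\<bar> \<le> a i * b" if "i < r" for i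
      proof -
        have "1 * b \<le> a i * b" using chain[OF that] a bb by (intro mult_right_mono) auto
        then show ?thesis using bb by linarith
      qed
      have gap: "(real k - 1) * (ln (real_of_int (a i)) + ln (real_of_int b))
          \<le> ln (real_of_int (a (Suc i))) + ln (real_of_int b') + real k * \<mu> + 2 * real k" if "Suc i < r" for i
        unfolding \<mu>_def
        by (rule gap_log_bound) (use that k a chain[of i] bb b n ab[of i] Bpw[of b] Bpw[of b'] in auto)
      have "g * ln (real_of_int (a (r - 1))) \<le> \<kappa> + real k * (1 + e) * \<mu> + E * ln (real_of_int b')"
        unfolding g_def \<mu>_def
        using \<kappa>(2)[of b b' "a (r - 1)" n] r a chain[of "r - 1"] bb b n ab[of "r - 1"]
          Bpw[of b "r - 1"] Bpw[of b' "r - 1"]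
        by (simp add: mult.commute)
      then have "L \<le> T0 * (1 + \<mu>)"
        unfolding L_def g_def
        by (intro T0(2)[of "\<lambda>i. ln (real_of_int (a i))" \<mu> "ln (real_of_int b')" "ln (real_of_int b)"])
          (use gap a \<mu> close in \<open>auto simp: L_def\<close>)
      then show False using TL[OF T(2)] by simp
    qed
    \<comment> \<open>Separated logarithms fall into different boxes of length \<open>e L\<close>, of which there are boundedly many.\<close>
    define \<phi> where "\<phi> = (\<lambda>b::int. nat \<lfloor>ln (real_of_int b) / (e * L)\<rfloor>)"
    have eL: "e * L > 0" using e L0 by simp
    have less: "\<phi> b < \<phi> b'" if b: "b \<in> B - {b0}" "b' \<in> B" "b < b'" for b b'
    proof -
      have "ln (real_of_int b) / (e * L) + 1 < ln (real_of_int b') / (e * L)"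
      proof -
        have "(ln (real_of_int b) + e * L) / (e * L) < ln (real_of_int b') / (e * L)"
          using sep[OF b] eL by (rule divide_strict_right_mono)
        then show ?thesis using e L0 by (simp add: add_divide_distrib)
      qed
      then have "\<lfloor>ln (real_of_int b) / (e * L)\<rfloor> < \<lfloor>ln (real_of_int b') / (e * L)\<rfloor>" by linarith
      moreover have "0 \<le> \<lfloor>ln (real_of_int b) / (e * L)\<rfloor>"
        using Bpos[of b] b eL by simp
      ultimately show ?thesis unfolding \<phi>_def by linarith
    qed
    have inj: "inj_on \<phi> (B - {b0})"
      by (rule inj_onI) (metis less DiffD1 less_irrefl linorder_neqE)
    have img: "\<phi> ` (B - {b0}) \<subseteq> {..nat \<lfloor>2 * U / e\<rfloor>}"
    proof (rule image_subsetI)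
      fix b assume "b \<in> B - {b0}"
      then have "ln (real_of_int b) / (e * L) \<le> 2 * U * L / (e * L)"
        using up eL by (intro divide_right_mono) auto
      also have "\<dots> = 2 * U / e" using L0 by simp
      finally show "\<phi> b \<in> {..nat \<lfloor>2 * U / e\<rfloor>}"
        unfolding \<phi>_def atMost_iff by (intro nat_mono floor_mono)
    qed
    have "finite (B - {b0})" using inj img by (rule inj_on_finite) simp
    then have fin: "finite B" by simp
    have "card (B - {b0}) \<le> card {..nat \<lfloor>2 * U / e\<rfloor>}"
      using inj img by (intro card_inj_on_le) auto
    moreover have "card B = Suc (card (B - {b0}))" using card_Suc_Diff1[OF fin b0(1)] by simp
    ultimately show ?thesis using fin unfolding J_def by simp
  qed
  then show ?thesis using T(1) by (intro exI[of _ T] conjI exI[of _ J]) auto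
qed

section \<open>The bounds\<close>

text \<open>
  The dichotomy on the second least element \<open>a 1\<close> of \<open>A\<close>. If it is at most polynomial in \<open>|n|\<close>, then so
  are the elements of \<open>B\<close> by ABC, and the count of common powers applies.
\<close>

lemma bipartite_tuple_bound:
  fixes \<epsilon> :: real
  assumes abc: "ABC_conjecture" and adm: "admissible k r" and \<epsilon>: "\<epsilon> > 0"
  shows "\<exists>C>0. \<forall>(n::int) A B. n \<noteq> 0 \<longrightarrow> bipartite_diophantine k n A B \<longrightarrow> finite A \<longrightarrow> r \<le> card A \<longrightarrow>
           finite B \<and> real (card B) \<le> C * \<bar>real_of_int n\<bar> powr \<epsilon>"
proof -
  have k: "k \<ge> 3" and r: "r \<ge> 2" using adm unfolding admissible_def by auto
  obtain T J where T: "T \<ge> 1" "\<And>(a::nat \<Rightarrow> int) n B. n \<noteq> 0 \<Longrightarrow> 0 < a 0 \<Longrightarrow> (\<forall>i. Suc i < r \<longrightarrow> a i < a (Suc i)) \<Longrightarrow>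
     B \<noteq> {} \<Longrightarrow> (\<forall>b\<in>B. b > 0 \<and> (\<forall>i<r. is_nth_power k (a i * b + n))) \<Longrightarrow>
     T * (1 + ln \<bar>real_of_int n\<bar>) < ln (real_of_int (a 1)) \<Longrightarrow> finite B \<and> card B \<le> J"
    using card_le_of_large_second_element[OF abc adm] by blast
  obtain U where U: "U \<ge> 0" "\<And>(a::int) a' b n. 0 < a \<Longrightarrow> a < a' \<Longrightarrow> 0 < b \<Longrightarrow> n \<noteq> 0 \<Longrightarrow>
     is_nth_power k (a * b + n) \<Longrightarrow> is_nth_power k (a' * b + n) \<Longrightarrow>
     ln (real_of_int b) \<le> U * (1 + ln \<bar>real_of_int n\<bar> + ln (real_of_int a'))"
    using abc_log_bound_uniform[OF abc k] by blast
  define V where "V = T + U * (1 + T)"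
  have V: "V \<ge> 0" unfolding V_def using T(1) U(1) by simp
  obtain C where C: "C > 0" "\<And>(a::int) a' n B. 0 < a \<Longrightarrow> a < a' \<Longrightarrow> n \<noteq> 0 \<Longrightarrow>
     (\<forall>b\<in>B. b > 0 \<and> is_nth_power k (a * b + n) \<and> is_nth_power k (a' * b + n)
          \<and> ln (real_of_int b) \<le> V * (1 + ln \<bar>real_of_int n\<bar>)) \<Longrightarrow>
     ln (real_of_int a') \<le> V * (1 + ln \<bar>real_of_int n\<bar>) \<Longrightarrow>
     finite B \<and> real (card B) \<le> C * \<bar>real_of_int n\<bar> powr \<epsilon>"
    using card_common_powers_le[OF k \<epsilon> V] by blast
  have main: "finite B \<and> real (card B) \<le> (C + real J) * \<bar>real_of_int n\<bar> powr \<epsilon>"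
    if n: "n \<noteq> 0" and bip: "bipartite_diophantine k n A B" and A: "finite A" "r \<le> card A" for n A B
  proof -
    define a where "a = (\<lambda>i. sorted_list_of_set A ! i)"
    have len: "length (sorted_list_of_set A) = card A" using A by simp
    have aA: "a i \<in> A" if "i < r" for i
      unfolding a_def using that A len nth_mem[of i "sorted_list_of_set A"] by simp
    have asc: "a i < a (Suc i)" if "Suc i < r" for i
      unfolding a_def using that A len
      by (intro sorted_wrt_nth_less[OF strict_sorted_list_of_set]) auto
    have a0: "0 < a 0" using aA[of 0] r bip unfolding bipartite_diophantine_def by auto
    have a01: "a 0 < a 1" using asc[of 0] r by simp
    have B: "b > 0" "i < r \<Longrightarrow> is_nth_power k (a i * b + n)" if "b \<in> B" for b i
      using bip that aA unfolding bipartite_diophantine_def by auto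
    have "B \<noteq> {}" using bip unfolding bipartite_diophantine_def by auto
    define \<mu> where "\<mu> = ln \<bar>real_of_int n\<bar>"
    have n1: "\<bar>real_of_int n\<bar> \<ge> 1" using n by linarith
    then have \<mu>: "\<mu> \<ge> 0" unfolding \<mu>_def by simp
    have powr1: "1 \<le> \<bar>real_of_int n\<bar> powr \<epsilon>" using n1 \<epsilon> by (simp add: ge_one_powr_ge_zero)
    show ?thesis
    proof (cases "T * (1 + \<mu>) < ln (real_of_int (a 1))")
      case True
      have *: "finite B \<and> card B \<le> J"
      proof (rule T(2)[of n a B, OF n a0 _ \<open>B \<noteq> {}\<close>])
        show "\<forall>i. Suc i < r \<longrightarrow> a i < a (Suc i)" using asc by blast
        show "\<forall>b\<in>B. b > 0 \<and> (\<forall>i<r. is_nth_power k (a i * b + n))" using B by blast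
      qed (use True in \<open>simp add: \<mu>_def\<close>)
      then have "real (card B) \<le> real J * 1" by simp
      also have "\<dots> \<le> (C + real J) * \<bar>real_of_int n\<bar> powr \<epsilon>"
        using C(1) powr1 by (intro mult_mono) auto
      finally show ?thesis using * by simp
    next
      case False
      have "T * (1 + \<mu>) \<le> V * (1 + \<mu>)"
        unfolding V_def using U(1) T(1) \<mu> by (intro mult_right_mono) auto
      then have a1: "ln (real_of_int (a 1)) \<le> V * (1 + \<mu>)" using False by linarith
      have lb: "ln (real_of_int b) \<le> V * (1 + \<mu>)" if b: "b \<in> B" for b
      proof -
        have "ln (real_of_int b) \<le> U * (1 + \<mu> + ln (real_of_int (a 1)))"
          unfolding \<mu>_def using r by (intro U(2)[OF a0 a01 B(1)[OF b] n] B(2)[OF b]) simp_all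
        also have "\<dots> \<le> U * (1 + \<mu> + T * (1 + \<mu>))"
          using U(1) False by (intro mult_left_mono) auto
        also have "\<dots> = U * (1 + T) * (1 + \<mu>)" by (simp add: algebra_simps)
        also have "\<dots> \<le> V * (1 + \<mu>)"
          unfolding V_def using T(1) \<mu> by (intro mult_right_mono) auto
        finally show ?thesis .
      qed
      have *: "finite B \<and> real (card B) \<le> C * \<bar>real_of_int n\<bar> powr \<epsilon>"
      proof (rule C(2)[OF a0 a01 n])
        have "0 < r" "1 < r" using r by simp_all
        then show "\<forall>b\<in>B. b > 0 \<and> is_nth_power k (a 0 * b + n) \<and> is_nth_power k (a 1 * b + n)
            \<and> ln (real_of_int b) \<le> V * (1 + ln \<bar>real_of_int n\<bar>)"
          using B lb unfolding \<mu>_def by blast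
      qed (use a1 in \<open>simp add: \<mu>_def\<close>)
      moreover have "C * \<bar>real_of_int n\<bar> powr \<epsilon> \<le> (C + real J) * \<bar>real_of_int n\<bar> powr \<epsilon>"
        by (intro mult_right_mono) auto
      ultimately show ?thesis by linarith
    qed
  qed
  have "C + real J > 0" using C(1) by simp
  with main show ?thesis by blast
qed

lemma bipartite_tuple_bound_powr:
  fixes \<epsilon> \<theta> :: real
  assumes abc: "ABC_conjecture" and adm: "admissible k r" and r': "r \<le> r'" and \<epsilon>: "\<epsilon> > 0" and \<theta>: "\<theta> \<ge> 0"
  shows "\<exists>C>0. \<forall>(n::int) A B. n \<noteq> 0 \<longrightarrow> bipartite_diophantine k n A B \<longrightarrow> card A = r' \<longrightarrow>
           finite B \<and> real (card B) \<le> C * \<bar>real_of_int n\<bar> powr (\<theta> + \<epsilon>)"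
proof -
  obtain C where C: "C > 0" "\<And>n A B. n \<noteq> 0 \<Longrightarrow> bipartite_diophantine k n A B \<Longrightarrow> finite A \<Longrightarrow> r \<le> card A \<Longrightarrow>
           finite B \<and> real (card B) \<le> C * \<bar>real_of_int n\<bar> powr \<epsilon>"
    using bipartite_tuple_bound[OF abc adm \<epsilon>] by blast
  have "finite B \<and> real (card B) \<le> C * \<bar>real_of_int n\<bar> powr (\<theta> + \<epsilon>)"
    if n: "n \<noteq> 0" and bip: "bipartite_diophantine k n A B" and A: "card A = r'" for n A B
  proof -
    have "r \<ge> 2" using adm unfolding admissible_def by auto
    then have "finite A" using A r' by (intro card_ge_0_finite) simp
    then have *: "finite B \<and> real (card B) \<le> C * \<bar>real_of_int n\<bar> powr \<epsilon>"
      using C(2)[OF n bip] A r' by simp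
    have "\<bar>real_of_int n\<bar> \<ge> 1" using n by linarith
    then have "\<bar>real_of_int n\<bar> powr \<epsilon> \<le> \<bar>real_of_int n\<bar> powr (\<theta> + \<epsilon>)"
      using \<theta> by (intro powr_mono) auto
    then have "C * \<bar>real_of_int n\<bar> powr \<epsilon> \<le> C * \<bar>real_of_int n\<bar> powr (\<theta> + \<epsilon>)"
      using C(1) by (intro mult_left_mono) auto
    then show ?thesis using * by linarith
  qed
  with C(1) show ?thesis by blast
qed

lemma totient_exponent_nonneg:
  assumes "k \<ge> 6"
  shows "0 \<le> (real k - 1) * real (totient k) / (real k * ((real k)\<^sup>2 - 6 * real k + 3))"
proof -
  have "0 \<le> real k * (real k - 6)" using assms by simp
  then have "0 \<le> (real k)\<^sup>2 - 6 * real k + 3" by (simp add: power2_eq_square algebra_simps)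
  then show ?thesis using assms by (intro divide_nonneg_nonneg mult_nonneg_nonneg) auto
qed

theorem theorem1p4:
  assumes "ABC_conjecture"
  shows "(\<forall>k::nat. k \<ge> 6 \<longrightarrow> (\<forall>\<epsilon>::real. \<epsilon> > 0 \<longrightarrow>
           (\<exists>C::real. C > 0 \<and> (\<forall>(n::int) A B.
              n \<noteq> 0 \<longrightarrow> bipartite_diophantine k n A B \<longrightarrow> card A = 2 \<longrightarrow>
              finite B \<and>
              real (card B) \<le> C * \<bar>real_of_int n\<bar> powr
                ((real k - 1) * real (totient k) / (real k * ((real k)^2 - 6 * real k + 3)) + \<epsilon>))))) \<and>
         (\<forall>\<epsilon>::real. \<epsilon> > 0 \<longrightarrow>
           (\<exists>C::real. C > 0 \<and> (\<forall>(n::int) A B.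
              n \<noteq> 0 \<longrightarrow> bipartite_diophantine 4 n A B \<longrightarrow> card A = 3 \<longrightarrow>
              finite B \<and> real (card B) \<le> C * \<bar>real_of_int n\<bar> powr (3 / 8 + \<epsilon>)))) \<and>
         (\<forall>\<epsilon>::real. \<epsilon> > 0 \<longrightarrow>
           (\<exists>C::real. C > 0 \<and> (\<forall>(n::int) A B.
              n \<noteq> 0 \<longrightarrow> bipartite_diophantine 5 n A B \<longrightarrow> card A = 3 \<longrightarrow>
              finite B \<and> real (card B) \<le> C * \<bar>real_of_int n\<bar> powr (64 / 625 + \<epsilon>)))) \<and>
         (\<forall>\<epsilon>::real. \<epsilon> > 0 \<longrightarrow>
           (\<exists>C::real. C > 0 \<and> (\<forall>(n::int) A B.
              n \<noteq> 0 \<longrightarrow> bipartite_diophantine 3 n A B \<longrightarrow> card A = 5 \<longrightarrow>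
              finite B \<and> real (card B) \<le> C * \<bar>real_of_int n\<bar> powr (32 / 81 + \<epsilon>))))"
proof (intro conjI allI impI)
  fix k :: nat and \<epsilon> :: real
  assume "k \<ge> 6" "\<epsilon> > 0"
  then show "\<exists>C::real. C > 0 \<and> (\<forall>(n::int) A B.
      n \<noteq> 0 \<longrightarrow> bipartite_diophantine k n A B \<longrightarrow> card A = 2 \<longrightarrow>
      finite B \<and> real (card B) \<le> C * \<bar>real_of_int n\<bar> powr
        ((real k - 1) * real (totient k) / (real k * ((real k)^2 - 6 * real k + 3)) + \<epsilon>))"
    by (intro bipartite_tuple_bound_powr[OF assms, of k 2 2] totient_exponent_nonneg)
      (auto simp: admissible_def)
next
  fix \<epsilon> :: real
  assume "\<epsilon> > 0"
  then show "\<exists>C::real. C > 0 \<and> (\<forall>(n::int) A B.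
      n \<noteq> 0 \<longrightarrow> bipartite_diophantine 4 n A B \<longrightarrow> card A = 3 \<longrightarrow>
      finite B \<and> real (card B) \<le> C * \<bar>real_of_int n\<bar> powr (3 / 8 + \<epsilon>))"
    by (intro bipartite_tuple_bound_powr[OF assms, of 4 3 3]) (auto simp: admissible_def)
next
  fix \<epsilon> :: real
  assume "\<epsilon> > 0"
  then show "\<exists>C::real. C > 0 \<and> (\<forall>(n::int) A B.
      n \<noteq> 0 \<longrightarrow> bipartite_diophantine 5 n A B \<longrightarrow> card A = 3 \<longrightarrow>
      finite B \<and> real (card B) \<le> C * \<bar>real_of_int n\<bar> powr (64 / 625 + \<epsilon>))"
    by (intro bipartite_tuple_bound_powr[OF assms, of 5 2 3]) (auto simp: admissible_def)
next
  fix \<epsilon> :: real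
  assume "\<epsilon> > 0"
  then show "\<exists>C::real. C > 0 \<and> (\<forall>(n::int) A B.
      n \<noteq> 0 \<longrightarrow> bipartite_diophantine 3 n A B \<longrightarrow> card A = 5 \<longrightarrow>
      finite B \<and> real (card B) \<le> C * \<bar>real_of_int n\<bar> powr (32 / 81 + \<epsilon>))"
    by (intro bipartite_tuple_bound_powr[OF assms, of 3 4 5]) (auto simp: admissible_def)
qed

end
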